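(* Let $p\geq 5$ be a prime, let $\lambda$ be a partition of a positive integer, and assume that the corresponding abelian $p$-group $G_{\lambda}$ is noncyclic. Then $$\mathrm{N}(\mathrm{P}(G_{\lambda}))\equiv 1 \pmod{p^{4}} \iff p \text{ is a Wolstenholme prime}.$$
   Context: For a finite group $G$, take independent commuting variables $x_g$ ($g\in G$) and let $M(G):=(x_{gh^{-1}})_{g,h\in G}$ be the group matrix. The group permanent is $\mathrm{P}(G):=\mathrm{perm}(M(G))=\sum_{\sigma}\prod_{g\in G}x_{g\sigma(g)^{-1}}\in\mathbb{Z}[x_g : g\in G]$, where $\sigma$ runs over all permutations of the set $G$. For a polynomial $f$, $\mathrm{N}(f)$ denotes the number of distinct monomials with nonzero coefficient in $f$. For a partition $\lambda=(k_1,\ldots,k_r)$, $k_1\ge\cdots\ge k_r\ge 1$, of a positive integer, the associated abelian $p$-group is $G_{\lambda}:=\mathrm{C}_{p^{k_1}}\times\mathrm{C}_{p^{k_2}}\times\cdots\times\mathrm{C}_{p^{k_r}}$, where $\mathrm{C}_n$ is the cyclic group of order $n$. A prime $p$ is called a Wolstenholme prime if $\binom{2p-1}{p-1}\equiv 1\pmod{p^4}$. *)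

theory Defs
  imports
    "HOL-Algebra.Product_Groups"
    "HOL-Library.Poly_Mapping"
    "HOL-Combinatorics.Permutations"
    "HOL-Number_Theory.Cong"
    "HOL-Computational_Algebra.Primes"
begin

text \<open>
  Polynomials with integer coefficients in variables indexed by the type \<open>'v\<close>: a monomial is its
  finitely supported exponent vector, a polynomial is a finitely supported function from monomials
  to coefficients, and the multiplication of \<^theory>\<open>HOL-Library.Poly_Mapping\<close> is the usual
  (convolution) product.
\<close>

type_synonym 'v int_mpoly = "('v \<Rightarrow>\<^sub>0 nat) \<Rightarrow>\<^sub>0 int"

definition var :: "'v \<Rightarrow> 'v int_mpoly" where
  "var v = Poly_Mapping.single (Poly_Mapping.single v 1) 1"

definition num_monomials :: "'v int_mpoly \<Rightarrow> nat" where
  "num_monomials f = card (Poly_Mapping.keys f)"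

definition permanent :: "'i set \<Rightarrow> ('i \<Rightarrow> 'i \<Rightarrow> 'r::comm_semiring_1) \<Rightarrow> 'r" where
  "permanent I A = (\<Sum>\<sigma> | \<sigma> permutes I. \<Prod>i\<in>I. A i (\<sigma> i))"

text \<open>
  The variables are indexed by the whole type \<open>'g\<close> rather than by the carrier of the group;
  only those with index in the carrier occur in the group permanent.
\<close>

definition group_matrix :: "('g, 'm) monoid_scheme \<Rightarrow> 'g \<Rightarrow> 'g \<Rightarrow> 'g int_mpoly" where
  "group_matrix G g h = var (g \<otimes>\<^bsub>G\<^esub> inv\<^bsub>G\<^esub> h)"

definition group_permanent :: "('g, 'm) monoid_scheme \<Rightarrow> 'g int_mpoly" where
  "group_permanent G = permanent (carrier G) (group_matrix G)"

definition is_partition :: "nat list \<Rightarrow> nat \<Rightarrow> bool" where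
  "is_partition ks n \<longleftrightarrow> sorted_wrt (\<ge>) ks \<and> (\<forall>k\<in>set ks. k \<ge> 1) \<and> sum_list ks = n"

definition abelian_p_group :: "nat \<Rightarrow> nat list \<Rightarrow> (nat \<Rightarrow> int) monoid" where
  "abelian_p_group p ks = product_group {..<length ks} (\<lambda>i. integer_mod_group (p ^ (ks ! i)))"

definition Wolstenholme_prime :: "nat \<Rightarrow> bool" where
  "Wolstenholme_prime p \<longleftrightarrow> prime p \<and> [(2 * p - 1) choose (p - 1) = 1] (mod p ^ 4)"

end

theory Submission
  imports Defs "HOL-Algebra.FiniteProduct" "HOL-Computational_Algebra.Polynomial_FPS" "HOL-Library.Real_Mod"
begin

text \<open>
Write \<open>G\<close> for the group, \<open>p ^ m\<close> for its order and \<open>B k\<close> for the binomial coefficient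
\<open>(2 * p ^ k - 1) choose (p ^ k - 1)\<close>.

The coefficients of a permanent of variables cannot cancel, so the number \<open>N\<close> of monomials is the number
of multisets \<open>{# g * inv (\<sigma> g) | g \<in> G #}\<close> that arise from permutations \<open>\<sigma>\<close>. The product of such a
multiset is \<open>1\<close>, and by a theorem of Marshall Hall (\<open>Hall_quotients\<close>) every multiset of \<open>|G|\<close> elements with
product \<open>1\<close> arises (\<open>quotient_msets_eq\<close>).

These multisets are counted by Fourier analysis. The characters of \<open>G\<close> are indexed by \<open>G\<close>
itself. Summing a character \<open>\<chi>\<close> over all multisets of size \<open>|G|\<close> gives the complete homogeneous
symmetric polynomial evaluated at the values of \<open>\<chi>\<close>. If \<open>\<chi>\<close> has order \<open>d = p ^ j\<close>, these values are the \<open>d\<close>-th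
roots of unity, each taken equally often, so the generating function is \<open>(1 - X ^ d)\<close> to the power
\<open>- |G| / d\<close>, and the coefficient in question is \<open>B (m - j)\<close>. Hence \<open>p ^ m * N\<close> is the sum of
\<open>B (m - j)\<close> over all characters (\<open>num_monomials_formula\<close>).

Let \<open>C j\<close> be the number of characters of order at most \<open>p ^ j\<close>. Summation by parts turns the formula into
\<open>p ^ m * (N - 1) = (\<Sum>k=1..m. (B k - B (k - 1)) * C (m - k))\<close>. For a noncyclic group no character has
order \<open>p ^ m\<close>, so \<open>C (m - 1) = p ^ m\<close> and the term \<open>k = 1\<close> is \<open>p ^ m * (B 1 - 1)\<close>. In the other terms
\<open>B k - B (k - 1)\<close> is divisible by \<open>p ^ (3 * k)\<close> (\<open>central_choose_prime_power_cong\<close>) and \<open>C (m - k)\<close> by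
\<open>p ^ (m - k)\<close>, so that they vanish modulo \<open>p ^ (m + 2 * k)\<close>, hence modulo \<open>p ^ (m + 4)\<close>. Therefore \<open>N\<close> is
congruent to \<open>B 1\<close> modulo \<open>p ^ 4\<close>, and \<open>B 1\<close> is the binomial coefficient in the definition of a Wolstenholme prime.
\<close>

section \<open>A congruence between binomial coefficients at consecutive prime powers\<close>

definition residue_units :: "int \<Rightarrow> int set" where
  "residue_units q = {i. 0 < i \<and> i < q \<and> coprime i q}"

lemma finite_residue_units [simp]: "finite (residue_units q)"
  by (rule finite_subset[of _ "{0..q}"]) (auto simp: residue_units_def)

lemma mod_in_residue_units:
  assumes "coprime x q" and "q > 1"
  shows "x mod q \<in> residue_units q"
proof -
  have "coprime (x mod q) q"
    using assms by (metis coprime_mod_left_iff less_irrefl not_one_less_zero)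
  moreover from this have "x mod q \<noteq> 0"
    using assms by (intro notI) simp
  then have "0 < x mod q"
    using \<open>q > 1\<close> pos_mod_sign[of q x] by linarith
  ultimately show ?thesis
    using \<open>q > 1\<close> pos_mod_bound[of q x] by (simp add: residue_units_def)
qed

lemma reflect_residue_units: "bij_betw (\<lambda>i. q - i) (residue_units q) (residue_units q)"
proof (rule bij_betw_byWitness[where f' = "\<lambda>i. q - i"])
  have "coprime (q - i) q" if "coprime i q" for i
    using that by (metis coprime_iff_gcd_eq_1 gcd.commute gcd_diff2)
  then show "(\<lambda>i. q - i) ` residue_units q \<subseteq> residue_units q"
    and "(\<lambda>i. q - i) ` residue_units q \<subseteq> residue_units q"
    by (auto simp: residue_units_def)
qed auto

text \<open>
Modulo \<open>q\<close> the number \<open>b i\<close> is minus the inverse square of \<open>i\<close>. Doubling permutes the units and divides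
each inverse square by \<open>4\<close>, so the sum equals four times itself, and \<open>3\<close> is a unit.
\<close>

lemma sum_inverse_squares_zero:
  fixes q :: int and b :: "int \<Rightarrow> int"
  assumes "coprime q 6" and "q > 1"
    and b: "\<And>i. i \<in> residue_units q \<Longrightarrow> [i * (q - i) * b i = 1] (mod q)"
  shows "q dvd (\<Sum>i\<in>residue_units q. b i)"
proof -
  let ?U = "residue_units q"
  have "coprime q 2" and "coprime q 3"
    using assms(1) by (auto intro: coprime_divisors[of q q _ 6])
  define f where "f i = (2 * i) mod q" for i
  have fU: "f i \<in> ?U" if "i \<in> ?U" for i
    using that \<open>coprime q 2\<close> \<open>q > 1\<close> unfolding f_def
    by (intro mod_in_residue_units) (auto simp: residue_units_def coprime_commute)
  have "inj_on f ?U"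
  proof (rule inj_onI)
    fix i j assume ij: "i \<in> ?U" "j \<in> ?U" "f i = f j"
    then have "[2 * i = 2 * j] (mod q)"
      by (simp add: f_def cong_def)
    then have "[i = j] (mod q)"
      using \<open>coprime q 2\<close> by (simp add: cong_mult_lcancel coprime_commute)
    then show "i = j"
      using ij by (auto simp: residue_units_def cong_def)
  qed
  then have bij: "bij_betw f ?U ?U"
    using fU by (simp add: bij_betw_def endo_inj_surj image_subset_iff)
  have step: "[4 * b (f i) = b i] (mod q)" if "i \<in> ?U" for i
  proof -
    define j where "j = f i"
    have j: "[j = 2 * i] (mod q)" by (simp add: j_def f_def cong_def)
    have bj: "[j * (q - j) * b j = 1] (mod q)" using b fU that by (simp add: j_def)
    have "[j * (q - j) = (2 * i) * (0 - 2 * i)] (mod q)"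
      using j by (intro cong_mult cong_diff) (auto simp: cong_def)
    also have "(2 * i) * (0 - 2 * i) = 4 * (i * (0 - i))" by simp
    also have "[4 * (i * (0 - i)) = 4 * (i * (q - i))] (mod q)"
      by (intro cong_mult cong_diff) (auto simp: cong_def)
    finally have "[4 * (i * (q - i)) * b j = 1] (mod q)"
      using bj by (meson cong_scalar_right cong_sym cong_trans)
    then have "[b i * (4 * (i * (q - i)) * b j) = b i * 1] (mod q)"
      by (rule cong_scalar_left)
    moreover have "[(i * (q - i) * b i) * (4 * b j) = 1 * (4 * b j)] (mod q)"
      using b that by (intro cong_scalar_right) auto
    ultimately show ?thesis
      unfolding j_def[symmetric] cong_def by (simp add: algebra_simps)
  qed
  have "[4 * (\<Sum>i\<in>?U. b (f i)) = (\<Sum>i\<in>?U. b i)] (mod q)"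
    unfolding sum_distrib_left by (intro cong_sum step)
  moreover have "(\<Sum>i\<in>?U. b (f i)) = (\<Sum>i\<in>?U. b i)"
    using sum.reindex_bij_betw[OF bij, of b] by simp
  ultimately have "q dvd 4 * (\<Sum>i\<in>?U. b i) - (\<Sum>i\<in>?U. b i)"
    by (simp add: cong_iff_dvd_diff)
  then have "q dvd 3 * (\<Sum>i\<in>?U. b i)" by simp
  then show ?thesis
    using \<open>coprime q 3\<close> coprime_dvd_mult_right_iff by blast
qed

lemma prod_one_plus_square_cong:
  fixes q :: int
  assumes "finite A"
  shows "[(\<Prod>i\<in>A. 1 + 2 * q^2 * b i) = 1 + 2 * q^2 * (\<Sum>i\<in>A. b i)] (mod q^3)"
  using assms
proof induction
  case (insert x A)
  let ?s = "\<Sum>i\<in>A. b i"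
  have "[(1 + 2 * q^2 * b x) * (\<Prod>i\<in>A. 1 + 2 * q^2 * b i)
      = (1 + 2 * q^2 * b x) * (1 + 2 * q^2 * ?s)] (mod q^3)"
    by (intro cong_mult insert.IH) simp
  also have "(1 + 2 * q^2 * b x) * (1 + 2 * q^2 * ?s)
      = 1 + 2 * q^2 * (b x + ?s) + q^3 * (4 * q * b x * ?s)"
    by (simp add: algebra_simps power2_eq_square power3_eq_cube)
  also have "[\<dots> = 1 + 2 * q^2 * (b x + ?s)] (mod q^3)"
    by (simp add: cong_iff_dvd_diff)
  finally show ?case using insert by simp
qed simp

text \<open>
The generalisation of Wolstenholme's congruence that is needed here. Pairing the unit \<open>i\<close> with \<open>q - i\<close> avoids terms that are
linear in \<open>q\<close>: the factors \<open>(q + i) * (2 * q - i)\<close> equal \<open>i * (q - i) + 2 * q\<^sup>2\<close>, and modulo \<open>q ^ 3\<close> only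
the part linear in \<open>q\<^sup>2\<close> survives, whose coefficient is a sum of inverse squares. Pairing within the
square of each product, rather than choosing one unit out of each pair, yields the congruence for the
squares; it descends because the sum of the two products is a unit.
\<close>

lemma prod_shifted_units_cong:
  fixes q :: int
  assumes "coprime q 6" and "q > 1"
  shows "[(\<Prod>i\<in>residue_units q. q + i) = (\<Prod>i\<in>residue_units q. i)] (mod q^3)"
proof -
  let ?U = "residue_units q"
  define P D where "P = (\<Prod>i\<in>?U. q + i)" and "D = (\<Prod>i\<in>?U. i)"
  have "coprime q 2"
    using assms(1) by (auto intro: coprime_divisors[of q q _ 6])
  have refl: "q - i \<in> ?U" if "i \<in> ?U" for i
    using that bij_betwE[OF reflect_residue_units] by blast
  have "\<exists>c. [i * (q - i) * c = 1] (mod q^3)" if "i \<in> ?U" for i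
    using that refl[OF that]
    by (intro cong_solve_coprime_int) (auto simp: residue_units_def)
  then obtain b where b: "\<And>i. i \<in> ?U \<Longrightarrow> [i * (q - i) * b i = 1] (mod q^3)"
    by metis
  have "[i * (q - i) * b i = 1] (mod q)" if "i \<in> ?U" for i
    using b[OF that] by (rule cong_dvd_modulus) simp
  then have "q dvd (\<Sum>i\<in>?U. b i)"
    by (rule sum_inverse_squares_zero[OF assms])
  then have "q^3 dvd 2 * q^2 * (\<Sum>i\<in>?U. b i)"
    by (metis dvd_mult dvd_mult_right mult.assoc mult.commute mult_dvd_mono dvd_refl power3_eq_cube power2_eq_square)
  then have sum0: "[1 + 2 * q^2 * (\<Sum>i\<in>?U. b i) = 1] (mod q^3)"
    by (simp add: cong_iff_dvd_diff)
  have P': "P = (\<Prod>i\<in>?U. q + (q - i))" and D': "D = (\<Prod>i\<in>?U. q - i)"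
    unfolding P_def D_def
    by (rule prod.reindex_bij_betw[OF reflect_residue_units, symmetric])+
  have "P\<^sup>2 = (\<Prod>i\<in>?U. (q + i) * (q + (q - i)))"
    unfolding power2_eq_square prod.distrib by (metis P' P_def)
  also have "[\<dots> = (\<Prod>i\<in>?U. i * (q - i) * (1 + 2 * q^2 * b i))] (mod q^3)"
  proof (rule cong_prod)
    fix i assume "i \<in> ?U"
    have "[i * (q - i) + 2 * q^2 * 1 = i * (q - i) + 2 * q^2 * (i * (q - i) * b i)] (mod q^3)"
      using b[OF \<open>i \<in> ?U\<close>] by (intro cong_add cong_mult) (auto simp: cong_sym_eq)
    then show "[(q + i) * (q + (q - i)) = i * (q - i) * (1 + 2 * q^2 * b i)] (mod q^3)"
      by (simp add: algebra_simps power2_eq_square)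
  qed
  also have "(\<Prod>i\<in>?U. i * (q - i) * (1 + 2 * q^2 * b i)) = D\<^sup>2 * (\<Prod>i\<in>?U. 1 + 2 * q^2 * b i)"
    unfolding power2_eq_square[of D] prod.distrib by (metis D' D_def)
  also have "[\<dots> = D\<^sup>2 * 1] (mod q^3)"
    by (intro cong_mult cong_trans[OF prod_one_plus_square_cong sum0]) simp_all
  finally have "q^3 dvd (P + D) * (P - D)"
    by (simp add: cong_iff_dvd_diff power2_eq_square algebra_simps)
  moreover have "coprime (P + D) q"
  proof -
    have "[P = D] (mod q)"
      unfolding P_def D_def by (intro cong_prod) (simp add: cong_def)
    then have "[P + D = 2 * D] (mod q)"
      by (metis cong_add_rcancel mult_2)
    moreover have "coprime D q"
      unfolding D_def by (intro prod_coprime_left) (simp add: residue_units_def)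
    then have "coprime (2 * D) q"
      using \<open>coprime q 2\<close> by (simp add: coprime_commute)
    ultimately show ?thesis
      by (metis cong_imp_coprime cong_sym)
  qed
  ultimately have "q^3 dvd P - D"
    by (metis coprime_commute coprime_dvd_mult_right_iff coprime_power_left_iff)
  then show ?thesis
    by (simp add: cong_iff_dvd_diff P_def D_def)
qed

text \<open>
For \<open>q > 0\<close> this is half of the central binomial coefficient \<open>(2 * q) choose q\<close>.
\<close>

definition central_choose :: "nat \<Rightarrow> nat" where
  "central_choose q = (2 * q - 1) choose (q - 1)"

lemma central_choose_prod:
  assumes "q > 0"
  shows "central_choose q * (\<Prod>i\<in>{1..<q}. i) = (\<Prod>i\<in>{1..<q}. q + i)"
proof -
  have "(fact (q + m) :: nat) = fact q * (\<Prod>i\<in>{1..m}. q + i)" for m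
    by (induction m) (auto simp: algebra_simps)
  from this[of "q - 1"] have "(fact (2 * q - 1) :: nat) = fact q * (\<Prod>i\<in>{1..<q}. q + i)"
    using assms by (simp add: mult_2 atLeastLessThanSuc_atLeastAtMost[symmetric])
  moreover have "fact (q - 1) * fact q * central_choose q = (fact (2 * q - 1) :: nat)"
    using binomial_fact_lemma[of "q - 1" "2 * q - 1"] assms by (simp add: central_choose_def mult_2)
  moreover have "(fact (q - 1) :: nat) = (\<Prod>i\<in>{1..<q}. i)"
    using assms by (cases q) (auto simp: fact_prod atLeastLessThanSuc_atLeastAtMost)
  ultimately show ?thesis by (simp add: mult.commute)
qed

text \<open>
The binomial coefficient for \<open>q\<close> is the product of the fractions \<open>(q + i) / i\<close> over \<open>0 < i < q\<close>. For
\<open>q = p * r\<close> the multiples of \<open>p\<close> among the \<open>i\<close> contribute exactly the binomial coefficient for \<open>r\<close>; the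
remaining \<open>i\<close> are the units modulo \<open>q\<close>, and their fractions multiply to \<open>1\<close> modulo \<open>q ^ 3\<close>.
\<close>

lemma central_choose_prime_power_cong:
  fixes p k :: nat
  assumes "prime p" and "p \<ge> 5" and "k > 0"
  shows "[int (central_choose (p ^ k)) = int (central_choose (p ^ (k - 1)))] (mod int p ^ (3 * k))"
proof -
  define q r where "q = p ^ k" and "r = p ^ (k - 1)"
  have q: "q = p * r" using \<open>k > 0\<close> by (simp add: q_def r_def flip: power_Suc)
  have "p > 0" "r > 0" "q > 1" 
    using assms one_less_power[of p k] by (auto simp: q_def r_def)
  define U where "U = {i \<in> {1..<q}. coprime i p}"
  have split: "(\<Prod>i\<in>{1..<q}. f i) = (\<Prod>i\<in>U. f i) * (\<Prod>i\<in>{1..<r}. f (p * i))" for f :: "nat \<Rightarrow> nat"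
  proof -
    have "{1..<q} = U \<union> (*) p ` {1..<r}" (is "_ = _ \<union> ?V")
    proof (intro equalityI subsetI)
      fix i assume i: "i \<in> {1..<q}"
      show "i \<in> U \<union> ?V"
      proof (cases "coprime i p")
        case False
        then have "p dvd i" using \<open>prime p\<close> by (metis coprime_commute prime_imp_coprime)
        then obtain j where "i = p * j" by blast
        then show ?thesis using i \<open>p > 0\<close> by (auto simp: q)
      qed (use i in \<open>auto simp: U_def\<close>)
    qed (use \<open>p > 0\<close> in \<open>auto simp: U_def q\<close>)
    moreover have "U \<inter> ?V = {}" using \<open>p \<ge> 5\<close> by (auto simp: U_def)
    moreover have "finite U" by (simp add: U_def)
    ultimately have "prod f {1..<q} = prod f U * prod f ?V"
      by (metis finite_atLeastLessThan finite_imageI prod.union_disjoint)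
    also have "prod f ?V = (\<Prod>i\<in>{1..<r}. f (p * i))"
      using \<open>p > 0\<close> by (subst prod.reindex) (auto simp: inj_on_def)
    finally show ?thesis .
  qed
  define P D F where "P = (\<Prod>i\<in>U. q + i)" and "D = (\<Prod>i\<in>U. i)" and "F = (\<Prod>i\<in>{1..<r}. i)"
  have "F > 0" by (auto simp: F_def intro!: prod_pos)
  have "central_choose q * (D * (p ^ (r - 1) * F)) = P * (p ^ (r - 1) * (central_choose r * F))"
    using central_choose_prod[of q] central_choose_prod[of r] \<open>q > 1\<close> \<open>r > 0\<close> \<open>p > 0\<close>
    unfolding split[of "\<lambda>i. i"] split[of "\<lambda>i. q + i"] P_def D_def F_def
    by (simp add: q prod.distrib flip: distrib_left)
  then have eq: "central_choose q * D = P * central_choose r"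
    using \<open>F > 0\<close> \<open>p > 0\<close> by (simp add: mult_ac)
  have copq: "coprime i q \<longleftrightarrow> coprime i p" for i
    using \<open>k > 0\<close> by (simp add: q_def)
  have bijU: "bij_betw int U (residue_units (int q))"
  proof (rule bij_betw_byWitness[where f' = nat])
    show "int ` U \<subseteq> residue_units (int q)"
      by (auto simp: U_def residue_units_def copq)
    show "nat ` residue_units (int q) \<subseteq> U"
      by (auto simp: U_def residue_units_def simp flip: copq)
        (auto simp flip: coprime_int_iff)
  qed (auto simp: residue_units_def)
  have P: "int P = (\<Prod>i\<in>residue_units (int q). int q + i)" and D: "int D = (\<Prod>i\<in>residue_units (int q). i)"
    using prod.reindex_bij_betw[OF bijU, of "\<lambda>i. int q + i"] prod.reindex_bij_betw[OF bijU, of "\<lambda>i. i"]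
    by (simp_all add: P_def D_def)
  have "coprime p 2" "coprime p 3"
    using assms by (auto intro!: primes_coprime simp del: coprime_right_2_iff_odd)
  then have "coprime p (2 * 3)"
    unfolding coprime_mult_right_iff ..
  then have "coprime (int q) 6"
    using coprime_int_iff[of q 6] by (simp add: q_def)
  then have "[int P = int D] (mod int q ^ 3)"
    unfolding P D using \<open>q > 1\<close> by (intro prod_shifted_units_cong) auto
  then have "[int P * int (central_choose r) = int D * int (central_choose r)] (mod int q ^ 3)"
    by (rule cong_scalar_right)
  moreover have "int P * int (central_choose r) = int D * int (central_choose q)"
    using eq by (metis mult.commute of_nat_mult)
  ultimately have "[int D * int (central_choose q) = int D * int (central_choose r)] (mod int q ^ 3)"
    by simp
  moreover have "coprime (int D) (int q ^ 3)"
    unfolding D by (auto intro!: prod_coprime_left simp: residue_units_def)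
  ultimately have "[int (central_choose q) = int (central_choose r)] (mod int q ^ 3)"
    using cong_mult_lcancel by blast
  then show ?thesis
    by (simp add: q_def r_def flip: power_mult) (simp add: mult.commute)
qed

section \<open>Hall's theorem on quotients in a finite abelian group\<close>

lemma bij_betw_rearrange:
  assumes f: "bij_betw f I S" and "finite I" and "A \<subseteq> I"
    and img: "g ` A = f ` A" and eq: "\<And>i. i \<in> I - A \<Longrightarrow> g i = f i"
  shows "bij_betw g I S"
proof -
  have "g ` I = g ` A \<union> g ` (I - A)" "f ` I = f ` A \<union> f ` (I - A)"
    using \<open>A \<subseteq> I\<close> by blast+
  moreover have "g ` (I - A) = f ` (I - A)"
    using eq by (rule image_cong[OF refl])
  ultimately have "g ` I = f ` I"
    using img by simp
  moreover have "f ` I = S" "card (f ` I) = card I"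
    using f by (auto simp: bij_betw_def card_image)
  ultimately show ?thesis
    using \<open>finite I\<close> by (simp add: bij_betw_def eq_card_imp_inj_on)
qed

context comm_group
begin

lemma mult_eq_mult_inv_swap:
  assumes "x \<in> carrier G" "y \<in> carrier G" "b \<in> carrier G" "k \<in> carrier G"
    and "x \<otimes> b = k \<otimes> inv y"
  shows "y \<otimes> b = k \<otimes> inv x"
proof -
  have "k = x \<otimes> b \<otimes> y"
    using assms by (metis inv_solve_right m_closed)
  then have "k = y \<otimes> b \<otimes> x"
    using assms(1-4) by (simp add: m_ac)
  then show ?thesis
    using assms(1-4) by (simp add: m_assoc)
qed

text \<open>
The heart of Hall's theorem: two quotients may be changed if their product is kept. The values of \<open>\<alpha>\<close>
are cycled along a path of indices, and \<open>\<gamma>\<close> is adapted.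

Give the new quotient \<open>b' r\<close> to \<open>\<alpha> r\<close>. If the resulting value is occupied by some index \<open>i\<close>, then
\<open>\<alpha> i\<close> becomes free, and \<open>b i\<close> is given to \<open>\<alpha> s\<close>, which is still free; this may evict another index, whose
quotient is given to \<open>\<alpha> i\<close>, and so on. As the total product is kept, the value claimed at each
step is \<open>k\<close> times the inverse of the element that stays free. So the index to be evicted is an
injective function \<open>nx\<close> of the index of the free element, and the path of evicted indices that starts at \<open>s\<close> cannot run
into itself before it reaches \<open>r\<close> or \<open>s\<close>. At that moment the value claimed is one of the two that
are available, and the last free element fits the other one with \<open>b' s\<close>.
\<close>

lemma exchange_two_quotients:
  assumes "finite I" and \<alpha>: "bij_betw \<alpha> I (carrier G)" and \<gamma>: "bij_betw \<gamma> I (carrier G)"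
    and \<gamma>\<alpha>: "\<And>i. i \<in> I \<Longrightarrow> \<gamma> i = \<alpha> i \<otimes> b i"
    and b: "b \<in> I \<rightarrow> carrier G" and b': "b' \<in> I \<rightarrow> carrier G"
    and rs: "r \<in> I" "s \<in> I" "r \<noteq> s"
    and same: "\<And>i. i \<in> I \<Longrightarrow> i \<noteq> r \<Longrightarrow> i \<noteq> s \<Longrightarrow> b' i = b i"
    and prod: "b' r \<otimes> b' s = b r \<otimes> b s"
  shows "\<exists>\<alpha>' \<gamma>'. bij_betw \<alpha>' I (carrier G) \<and> bij_betw \<gamma>' I (carrier G)
    \<and> (\<forall>i\<in>I. \<gamma>' i = \<alpha>' i \<otimes> b' i)"
proof -
  have \<alpha>c: "\<alpha> i \<in> carrier G" and \<gamma>c: "\<gamma> i \<in> carrier G" if "i \<in> I" for i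
    using that \<alpha> \<gamma> by (auto dest: bij_betwE)
  have bc: "b i \<in> carrier G" and b'c: "b' i \<in> carrier G" if "i \<in> I" for i
    using that b b' by auto
  define k where "k = \<alpha> r \<otimes> \<alpha> s \<otimes> b' r"
  have kc: "k \<in> carrier G" using rs \<alpha>c b'c by (simp add: k_def)
  \<comment> \<open>\<open>nx i\<close> is the index whose \<open>\<gamma>\<close>-value is claimed while \<open>\<alpha> i\<close> stays free.\<close>
  define nx where "nx i = (if i \<in> I then inv_into I \<gamma> (k \<otimes> inv \<alpha> i) else i)" for i
  have kmem: "k \<otimes> inv \<alpha> i \<in> \<gamma> ` I" if "i \<in> I" for i
    using \<gamma> kc \<alpha>c[OF that] by (simp add: bij_betw_def)
  have nxI: "nx i \<in> I" and \<gamma>nx: "\<gamma> (nx i) = k \<otimes> inv \<alpha> i" if "i \<in> I" for i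
    using kmem[OF that] that by (auto simp: nx_def inv_into_into f_inv_into_f)
  have "inj_on nx I"
  proof (rule inj_onI)
    fix i j assume ij: "i \<in> I" "j \<in> I" "nx i = nx j"
    then have "k \<otimes> inv \<alpha> i = k \<otimes> inv \<alpha> j" using \<gamma>nx by metis
    then have "inv \<alpha> i = inv \<alpha> j" using ij \<alpha>c kc by simp
    then have "\<alpha> i = \<alpha> j" using ij \<alpha>c inv_inv by metis
    then show "i = j" using \<alpha> ij by (auto simp: bij_betw_def dest: inj_onD)
  qed
  then have "bij_betw nx I I"
    using \<open>finite I\<close> nxI by (simp add: bij_betw_def endo_inj_surj image_subset_iff)
  then have nx: "nx permutes I"
    by (rule bij_imp_permutes) (simp add: nx_def)
  then have "permutation nx"
    using \<open>finite I\<close> by (auto simp: permutation_permutes)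
  then obtain N where N: "N > 0" "(nx ^^ N) s = s"
    using permutation_self[of nx s] by blast
  define idx where "idx t = (nx ^^ t) s" for t
  have idx_Suc: "idx (Suc t) = nx (idx t)" for t
    by (simp add: idx_def)
  have idxI: "idx t \<in> I" for t
    by (induction t) (use rs nxI in \<open>auto simp: idx_Suc\<close>, simp add: idx_def)
  have \<gamma>idx: "\<gamma> (idx (Suc t)) = k \<otimes> inv \<alpha> (idx t)" for t
    using \<gamma>nx idxI by (simp add: idx_Suc)
  define T where "T = (LEAST t. idx (Suc t) \<in> {r, s})"
  \<comment> \<open>The orbit of \<open>s\<close> under the permutation \<open>nx\<close> returns to \<open>s\<close>, so the path ends.\<close>
  have "idx (Suc (N - 1)) \<in> {r, s}"
    using N by (simp add: idx_def)
  then have endT: "idx (Suc T) \<in> {r, s}"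
    unfolding T_def by (rule LeastI)
  have notrs: "idx (Suc t) \<notin> {r, s}" if "t < T" for t
    using that not_less_Least unfolding T_def by blast
  have notr: "idx t \<noteq> r" if "t \<le> T" for t
    using that notrs \<open>r \<noteq> s\<close> by (cases t) (auto simp: idx_def)
  define A where "A = idx ` {..T}"
  have A_Suc: "A = insert s ((\<lambda>t. idx (Suc t)) ` {..<T})"
  proof -
    have "{..T} = insert 0 (Suc ` {..<T})"
      by (simp add: lessThan_Suc_atMost[symmetric] lessThan_Suc_eq_insert_0 del: lessThan_Suc)
    then show ?thesis by (simp add: A_def image_image) (simp add: idx_def)
  qed
  have A_T: "A = insert (idx T) (idx ` {..<T})"
    by (auto simp: A_def lessThan_Suc_atMost[symmetric] lessThan_Suc)
  have "A \<subseteq> I" "r \<notin> A"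
    using idxI notr by (auto simp: A_def)
  define other where "other = (if idx (Suc T) = r then s else r)"
  have other: "{idx (Suc T), other} = {r, s}" "idx (Suc T) \<noteq> other" "other \<in> I"
    using endT rs by (auto simp: other_def)

  \<comment> \<open>The new \<open>\<alpha>\<close> moves each value one step along the cycle \<open>idx 0, \<dots>, idx T\<close>.\<close>
  define \<alpha>' where "\<alpha>' i = (if i = s then \<alpha> (idx T) else if i \<in> A then \<alpha> (Hilbert_Choice.inv nx i) else \<alpha> i)" for i
  define \<gamma>' where "\<gamma>' i = \<alpha>' i \<otimes> b' i" for i
  have \<alpha>'_Suc: "\<alpha>' (idx (Suc t)) = \<alpha> (idx t)" if "t < T" for t
  proof -
    have "Hilbert_Choice.inv nx (idx (Suc t)) = idx t"
      using nx by (simp add: idx_Suc permutes_inverses)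
    then show ?thesis
      using that notrs[OF that] by (auto simp: \<alpha>'_def A_def)
  qed
  have \<alpha>'_s: "\<alpha>' s = \<alpha> (idx T)" by (simp add: \<alpha>'_def)
  have \<alpha>'_out: "\<alpha>' i = \<alpha> i" if "i \<notin> A" for i
    using that by (auto simp: \<alpha>'_def A_Suc)
  have "\<alpha>' ` A = \<alpha> ` A"
  proof -
    have "\<alpha>' ` A = insert (\<alpha> (idx T)) ((\<lambda>t. \<alpha> (idx t)) ` {..<T})"
      unfolding A_Suc by (simp add: \<alpha>'_s image_image \<alpha>'_Suc cong: image_cong_simp)
    also have "\<dots> = \<alpha> ` A"
      unfolding A_T by (simp add: image_image)
    finally show ?thesis .
  qed
  then have "bij_betw \<alpha>' I (carrier G)"
    using bij_betw_rearrange[OF \<alpha> \<open>finite I\<close> \<open>A \<subseteq> I\<close>] \<alpha>'_out by blast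

  have "\<gamma>' r = k \<otimes> inv \<alpha> s"
    using rs \<alpha>c b'c kc \<open>r \<notin> A\<close>
    by (simp add: \<gamma>'_def \<alpha>'_out inv_solve_right) (simp add: k_def m_ac)
  then have \<gamma>'_r: "\<gamma>' r = \<gamma> (idx (Suc 0))"
    using \<gamma>idx[of 0] by (simp add: idx_def)
  have \<gamma>'_Suc: "\<gamma>' (idx (Suc t)) = \<gamma> (idx (Suc (Suc t)))" if "t < T" for t
  proof -
    have "\<alpha> (idx (Suc t)) \<otimes> b (idx (Suc t)) = k \<otimes> inv \<alpha> (idx t)"
      using \<gamma>\<alpha> idxI \<gamma>idx by metis
    then have "\<alpha> (idx t) \<otimes> b (idx (Suc t)) = k \<otimes> inv \<alpha> (idx (Suc t))"
      by (rule mult_eq_mult_inv_swap[OF \<alpha>c[OF idxI] \<alpha>c[OF idxI] bc[OF idxI] kc])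
    then show ?thesis
      using same[OF idxI, of "Suc t"] notrs[OF that] \<alpha>'_Suc[OF that] \<gamma>idx[of "Suc t"]
      by (simp add: \<gamma>'_def)
  qed
  have \<gamma>'_s: "\<gamma>' s = \<gamma> other"
  proof -
    have "\<gamma> (idx (Suc T)) \<otimes> \<gamma> other = \<gamma> r \<otimes> \<gamma> s"
      using other \<gamma>c rs by (auto simp: doubleton_eq_iff m_comm)
    also have "\<dots> = (\<alpha> r \<otimes> \<alpha> s) \<otimes> (b r \<otimes> b s)"
      using \<gamma>\<alpha> \<alpha>c bc rs by (simp add: m_ac)
    also have "\<dots> = k \<otimes> b' s"
      using \<alpha>c b'c rs by (simp add: k_def m_assoc flip: prod)
    also have "b' s = inv \<alpha> (idx T) \<otimes> (\<alpha> (idx T) \<otimes> b' s)"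
      using b'c[OF rs(2)] \<alpha>c[OF idxI] by (simp add: inv_solve_left)
    also have "k \<otimes> \<dots> = \<gamma> (idx (Suc T)) \<otimes> (\<alpha> (idx T) \<otimes> b' s)"
      using kc b'c[OF rs(2)] \<alpha>c[OF idxI] by (simp add: \<gamma>idx m_assoc)
    finally have "\<gamma> other = \<alpha> (idx T) \<otimes> b' s"
      using \<gamma>c[OF idxI] \<gamma>c[OF other(3)] b'c[OF rs(2)] \<alpha>c[OF idxI] by simp
    then show ?thesis by (simp add: \<gamma>'_def \<alpha>'_s)
  qed
  have "\<gamma>' ` insert r A = \<gamma> ` insert r A"
  proof -
    have "\<gamma>' ` insert r A = {\<gamma> (idx (Suc 0)), \<gamma> other} \<union> (\<lambda>t. \<gamma> (idx (Suc (Suc t)))) ` {..<T}"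
      unfolding A_Suc by (auto simp: \<gamma>'_r \<gamma>'_s image_image \<gamma>'_Suc cong: image_cong_simp)
    also have "\<dots> = insert (\<gamma> other) ((\<lambda>t. \<gamma> (idx (Suc t))) ` {..T})"
    proof -
      have "{..T} = insert 0 (Suc ` {..<T})"
        by (simp add: lessThan_Suc_atMost[symmetric] lessThan_Suc_eq_insert_0 del: lessThan_Suc)
      then show ?thesis by (simp add: image_image insert_commute)
    qed
    also have "\<dots> = \<gamma> ` ({idx (Suc T), other} \<union> (\<lambda>t. idx (Suc t)) ` {..<T})"
      by (auto simp: image_image lessThan_Suc_atMost[symmetric] lessThan_Suc)
    also have "{idx (Suc T), other} \<union> (\<lambda>t. idx (Suc t)) ` {..<T} = insert r A"
      unfolding other(1) A_Suc by auto
    finally show ?thesis .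
  qed
  moreover have "\<gamma>' i = \<gamma> i" if "i \<in> I - insert r A" for i
    using that same[of i] \<gamma>\<alpha>[of i] by (auto simp: \<gamma>'_def \<alpha>'_out A_Suc)
  ultimately have "bij_betw \<gamma>' I (carrier G)"
    using bij_betw_rearrange[OF \<gamma> \<open>finite I\<close>, of "insert r A"] \<open>A \<subseteq> I\<close> rs by blast
  then show ?thesis
    using \<open>bij_betw \<alpha>' I (carrier G)\<close> \<gamma>'_def by blast
qed

text \<open>
Starting from the constant family \<open>\<one>\<close>, the quotients are corrected one index at a time, while one fixed
index \<open>l\<close> absorbs the change in the product.
\<close>

theorem Hall_quotients:
  assumes fin: "finite (carrier G)" "finite I" and card: "card I = Coset.order G"
    and b: "b \<in> I \<rightarrow> carrier G" and prod: "finprod G b I = \<one>"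
  shows "\<exists>\<alpha> \<gamma>. bij_betw \<alpha> I (carrier G) \<and> bij_betw \<gamma> I (carrier G)
    \<and> (\<forall>i\<in>I. \<gamma> i = \<alpha> i \<otimes> b i)"
proof -
  have "card I > 0"
    using fin card by (simp add: order_gt_0_iff_finite)
  then obtain l where l: "l \<in> I" by fastforce
  \<comment> \<open>The family with the correct quotients on \<open>J\<close>, with \<open>\<one>\<close> elsewhere and with the defect at \<open>l\<close>.\<close>
  define c where "c J i = (if i = l then inv (finprod G b J) else if i \<in> J then b i else \<one>)" for J i
  have clos: "finprod G b J \<in> carrier G" if "J \<subseteq> I" for J
    using that b by (intro finprod_closed) auto
  have "\<exists>\<alpha> \<gamma>. bij_betw \<alpha> I (carrier G) \<and> bij_betw \<gamma> I (carrier G) \<and> (\<forall>i\<in>I. \<gamma> i = \<alpha> i \<otimes> c J i)"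
    if "finite J" "J \<subseteq> I - {l}" for J
    using that
  proof (induction J)
    case empty
    obtain f where f: "bij_betw f I (carrier G)"
      using fin card finite_same_card_bij unfolding Coset.order_def by blast
    then have "\<forall>i\<in>I. f i = f i \<otimes> c {} i"
      by (auto simp: c_def dest: bij_betwE)
    then show ?case using f by blast
  next
    case (insert j J)
    then have j: "j \<in> I" "j \<noteq> l" "J \<subseteq> I" "insert j J \<subseteq> I" and bj: "b j \<in> carrier G"
      using b by auto
    obtain \<alpha> \<gamma> where *: "bij_betw \<alpha> I (carrier G)" "bij_betw \<gamma> I (carrier G)"
      "\<And>i. i \<in> I \<Longrightarrow> \<gamma> i = \<alpha> i \<otimes> c J i"
      using insert by blast
    have ins: "finprod G b (insert j J) = b j \<otimes> finprod G b J"
      using insert b by (intro finprod_insert) auto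
    show ?case
    proof (rule exchange_two_quotients[OF fin(2) *, where r = j and s = l])
      show "c J \<in> I \<rightarrow> carrier G" "c (insert j J) \<in> I \<rightarrow> carrier G"
        using clos[OF j(3)] clos[OF j(4)] b by (auto simp: c_def)
      show "c (insert j J) j \<otimes> c (insert j J) l = c J j \<otimes> c J l"
        using j clos[OF j(3)] bj insert.hyps
        by (simp add: c_def ins inv_mult m_assoc[symmetric])
    qed (use j l in \<open>auto simp: c_def\<close>)
  qed
  from this[of "I - {l}"] obtain \<alpha> \<gamma> where *: "bij_betw \<alpha> I (carrier G)" "bij_betw \<gamma> I (carrier G)"
      "\<And>i. i \<in> I \<Longrightarrow> \<gamma> i = \<alpha> i \<otimes> c (I - {l}) i"
    using fin by auto
  have "b l \<otimes> finprod G b (I - {l}) = finprod G b (insert l (I - {l}))"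
    using fin b l by (intro finprod_insert[symmetric]) auto
  also have "\<dots> = \<one>"
    using l prod by (simp add: insert_absorb)
  finally have "inv (finprod G b (I - {l})) = b l"
    using b l clos[of "I - {l}"] by (intro inv_equality) auto
  then have "c (I - {l}) i = b i" if "i \<in> I" for i
    using that by (auto simp: c_def)
  then show ?thesis using * by metis
qed

end

section \<open>Monomials of the group permanent\<close>

definition monomial_of :: "'v multiset \<Rightarrow> ('v \<Rightarrow>\<^sub>0 nat)" where
  "monomial_of M = (\<Sum>x\<in>#M. Poly_Mapping.single x 1)"

lemma monomial_of_simps [simp]:
  "monomial_of {#} = 0"
  "monomial_of (add_mset x M) = Poly_Mapping.single x 1 + monomial_of M"
  by (simp_all add: monomial_of_def)

lemma lookup_monomial_of: "Poly_Mapping.lookup (monomial_of M) x = count M x"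
  by (induction M) (auto simp: lookup_add lookup_single when_def)

lemma inj_monomial_of: "inj monomial_of"
  by (intro injI multiset_eqI) (metis lookup_monomial_of)

lemma prod_var:
  assumes "finite A"
  shows "(\<Prod>i\<in>A. var (f i)) = Poly_Mapping.single (monomial_of (image_mset f (mset_set A))) 1"
  using assms by induction (simp_all add: var_def mult_single)

text \<open>
All coefficients are positive, so nothing cancels.
\<close>

lemma keys_sum_monomials:
  fixes m :: "'i \<Rightarrow> 'v \<Rightarrow>\<^sub>0 nat"
  assumes "finite S"
  shows "Poly_Mapping.keys (\<Sum>i\<in>S. Poly_Mapping.single (m i) (1::int)) = m ` S"
proof -
  have "Poly_Mapping.lookup (\<Sum>i\<in>S. Poly_Mapping.single (m i) (1::int)) e = int (card {i \<in> S. m i = e})" for e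
  proof -
    have "Poly_Mapping.lookup (\<Sum>i\<in>S. Poly_Mapping.single (m i) (1::int)) e = (\<Sum>i\<in>S. if m i = e then 1 else 0)"
      unfolding lookup_sum by (intro sum.cong) (auto simp: lookup_single when_def)
    then show ?thesis
      using assms by (simp add: sum.If_cases Int_def)
  qed
  then show ?thesis
    using assms by (auto simp: in_keys_iff card_eq_0_iff)
qed

definition quotient_mset :: "('g, 'm) monoid_scheme \<Rightarrow> ('g \<Rightarrow> 'g) \<Rightarrow> 'g multiset" where
  "quotient_mset G \<sigma> = image_mset (\<lambda>g. g \<otimes>\<^bsub>G\<^esub> inv\<^bsub>G\<^esub> \<sigma> g) (mset_set (carrier G))"

lemma num_monomials_group_permanent:
  assumes "finite (carrier G)"
  shows "num_monomials (group_permanent G) = card (quotient_mset G ` {\<sigma>. \<sigma> permutes carrier G})"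
proof -
  have "group_permanent G = (\<Sum>\<sigma> | \<sigma> permutes carrier G. Poly_Mapping.single (monomial_of (quotient_mset G \<sigma>)) 1)"
    using assms by (simp add: group_permanent_def permanent_def group_matrix_def prod_var quotient_mset_def)
  then have "Poly_Mapping.keys (group_permanent G) = (\<lambda>\<sigma>. monomial_of (quotient_mset G \<sigma>)) ` {\<sigma>. \<sigma> permutes carrier G}"
    using assms by (simp only: keys_sum_monomials finite_permutations)
  also have "\<dots> = monomial_of ` (quotient_mset G ` {\<sigma>. \<sigma> permutes carrier G})"
    by (simp add: image_image)
  finally show ?thesis
    by (simp add: num_monomials_def card_image[OF inj_on_subset[OF inj_monomial_of]])
qed

text \<open>
With the whole carrier as index set, instead of the support of \<open>M\<close>, adding an element to \<open>M\<close> multiplies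
two families over the same set. The value is meaningful for a finite carrier that contains \<open>M\<close>.
\<close>

definition mset_prod :: "('g, 'm) monoid_scheme \<Rightarrow> 'g multiset \<Rightarrow> 'g" where
  "mset_prod G M = finprod G (\<lambda>x. x [^]\<^bsub>G\<^esub> count M x) (carrier G)"

context comm_group
begin

lemma mset_prod_closed [simp]: "mset_prod G M \<in> carrier G"
  by (simp add: mset_prod_def)

lemma mset_prod_empty [simp]: "mset_prod G {#} = \<one>"
  by (simp add: mset_prod_def)

lemma mset_prod_add:
  assumes "finite (carrier G)" and a: "a \<in> carrier G"
  shows "mset_prod G (add_mset a M) = a \<otimes> mset_prod G M"
proof -
  have "mset_prod G (add_mset a M) = (\<Otimes>x\<in>carrier G. (if a = x then x else \<one>) \<otimes> x [^] count M x)"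
    unfolding mset_prod_def by (intro finprod_cong') (auto simp: m_comm)
  also have "\<dots> = (\<Otimes>x\<in>carrier G. if a = x then x else \<one>) \<otimes> mset_prod G M"
    unfolding mset_prod_def by (rule finprod_multf) auto
  also have "(\<Otimes>x\<in>carrier G. if a = x then x else \<one>) = a"
    using finprod_singleton[OF a assms(1), of "\<lambda>x. x"] by simp
  finally show ?thesis .
qed

lemma mset_prod_image_mset:
  assumes "finite (carrier G)" "finite I" "b \<in> I \<rightarrow> carrier G"
  shows "mset_prod G (image_mset b (mset_set I)) = finprod G b I"
  using assms(2,3) by induction (simp_all add: mset_prod_add[OF assms(1)])

lemma quotient_msets_eq:
  assumes fin: "finite (carrier G)"
  shows "quotient_mset G ` {\<sigma>. \<sigma> permutes carrier G}
    = {M \<in> multisets_of_size (carrier G) (Coset.order G). mset_prod G M = \<one>}"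
proof (intro equalityI subsetI)
  fix M assume "M \<in> quotient_mset G ` {\<sigma>. \<sigma> permutes carrier G}"
  then obtain \<sigma> where \<sigma>: "\<sigma> permutes carrier G"
    and M: "M = image_mset (\<lambda>g. g \<otimes> inv \<sigma> g) (mset_set (carrier G))"
    by (auto simp: quotient_mset_def)
  have \<sigma>c: "\<sigma> g \<in> carrier G" if "g \<in> carrier G" for g
    using that \<sigma> by (simp add: permutes_in_image)
  define Q where "Q = (\<Otimes>g\<in>carrier G. g \<otimes> inv \<sigma> g)"
  define S where "S = (\<Otimes>g\<in>carrier G. g)"
  have QS: "Q \<in> carrier G" "S \<in> carrier G"
    using \<sigma>c by (auto simp: Q_def S_def intro!: finprod_closed)
  have "S = (\<Otimes>g\<in>carrier G. (g \<otimes> inv \<sigma> g) \<otimes> \<sigma> g)"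
    unfolding S_def using \<sigma>c by (intro finprod_cong') (auto simp: m_assoc)
  also have "\<dots> = Q \<otimes> (\<Otimes>g\<in>carrier G. \<sigma> g)"
    unfolding Q_def using \<sigma>c by (intro finprod_multf) auto
  also have "(\<Otimes>g\<in>carrier G. \<sigma> g) = S"
    using finprod_reindex[of "\<lambda>g. g" \<sigma> "carrier G"] \<sigma>
    by (auto simp: S_def permutes_image permutes_inj_on)
  finally have "Q = \<one>" using QS by simp
  moreover have "mset_prod G M = Q"
    unfolding M Q_def using \<sigma>c by (intro mset_prod_image_mset fin) auto
  moreover have "M \<in> multisets_of_size (carrier G) (Coset.order G)"
    using fin \<sigma>c by (auto simp: M multisets_of_size_def Coset.order_def)
  ultimately show "M \<in> {M \<in> multisets_of_size (carrier G) (Coset.order G). mset_prod G M = \<one>}"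
    by simp
next
  fix M assume "M \<in> {M \<in> multisets_of_size (carrier G) (Coset.order G). mset_prod G M = \<one>}"
  then have M: "set_mset M \<subseteq> carrier G" "size M = Coset.order G" "mset_prod G M = \<one>"
    by (auto simp: multisets_of_size_def)
  obtain xs where xs: "mset xs = M" by (metis ex_mset)
  define I where "I = {..<Coset.order G}"
  have len: "length xs = Coset.order G" using M xs by auto
  have Mb: "M = image_mset ((!) xs) (mset_set I)"
    using xs len by (metis I_def atLeast0LessThan map_nth mset_map mset_set_upto_eq_mset_upto)
  have b: "(!) xs \<in> I \<rightarrow> carrier G"
    using M xs len by (auto simp: I_def)
  have "finprod G ((!) xs) I = \<one>"
    using M(3) mset_prod_image_mset[OF fin _ b] by (simp add: Mb I_def)
  then obtain \<alpha> \<gamma> where \<alpha>: "bij_betw \<alpha> I (carrier G)" and \<gamma>: "bij_betw \<gamma> I (carrier G)"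
    and eq: "\<And>i. i \<in> I \<Longrightarrow> \<gamma> i = \<alpha> i \<otimes> xs ! i"
    using Hall_quotients[OF fin _ _ b] by (auto simp: I_def)
  define \<sigma> where "\<sigma> g = (if g \<in> carrier G then \<alpha> (the_inv_into I \<gamma> g) else g)" for g
  have "bij_betw (\<alpha> \<circ> the_inv_into I \<gamma>) (carrier G) (carrier G)"
    using bij_betw_trans[OF bij_betw_the_inv_into[OF \<gamma>] \<alpha>] .
  then have "bij_betw \<sigma> (carrier G) (carrier G)"
    by (subst bij_betw_cong[where g = "\<alpha> \<circ> the_inv_into I \<gamma>"]) (auto simp: \<sigma>_def)
  then have "\<sigma> permutes carrier G"
    by (rule bij_imp_permutes) (simp add: \<sigma>_def)
  moreover have "quotient_mset G \<sigma> = M"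
  proof -
    have "mset_set (carrier G) = image_mset \<gamma> (mset_set I)"
      using \<gamma> by (simp add: image_mset_mset_set bij_betw_def)
    then have "quotient_mset G \<sigma> = image_mset (\<lambda>i. \<gamma> i \<otimes> inv \<sigma> (\<gamma> i)) (mset_set I)"
      by (simp add: quotient_mset_def multiset.map_comp comp_def)
    also have "\<dots> = image_mset ((!) xs) (mset_set I)"
    proof (rule image_mset_cong)
      fix i assume "i \<in># mset_set I"
      then have i: "i \<in> I" by (simp add: I_def)
      then have c: "\<alpha> i \<in> carrier G" "\<gamma> i \<in> carrier G" "xs ! i \<in> carrier G"
        using \<alpha> \<gamma> b by (auto dest: bij_betwE)
      have "\<sigma> (\<gamma> i) = \<alpha> i"
        using i c \<gamma> by (simp add: \<sigma>_def the_inv_into_f_f bij_betw_def)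
      then show "\<gamma> i \<otimes> inv \<sigma> (\<gamma> i) = xs ! i"
        using c eq[OF i] m_comm[OF c(1,3)] by (simp add: inv_solve_right')
    qed
    finally show ?thesis using Mb by simp
  qed
  ultimately show "M \<in> quotient_mset G ` {\<sigma>. \<sigma> permutes carrier G}"
    by blast
qed

end

section \<open>Counting multisets with given product by characters\<close>

text \<open>
The complete homogeneous symmetric polynomial of degree \<open>n\<close> in the variables indexed by \<open>S\<close>, evaluated at \<open>a\<close>.
\<close>

definition complete_hom :: "('a \<Rightarrow> 'b::comm_semiring_1) \<Rightarrow> 'a set \<Rightarrow> nat \<Rightarrow> 'b" where
  "complete_hom a S n = (\<Sum>M\<in>multisets_of_size S n. \<Prod>x\<in>#M. a x)"

lemma multisets_of_size_insert_Suc: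
  assumes "x \<notin> S"
  shows "multisets_of_size (insert x S) (Suc n)
    = multisets_of_size S (Suc n) \<union> add_mset x ` multisets_of_size (insert x S) n"
proof (intro equalityI subsetI)
  fix M assume M: "M \<in> multisets_of_size (insert x S) (Suc n)"
  show "M \<in> multisets_of_size S (Suc n) \<union> add_mset x ` multisets_of_size (insert x S) n"
  proof (cases "x \<in># M")
    case True
    then obtain M' where "M = add_mset x M'" by (metis insert_DiffM)
    then show ?thesis using M by (auto simp: multisets_of_size_def)
  qed (use M in \<open>auto simp: multisets_of_size_def\<close>)
qed (auto simp: multisets_of_size_def)

lemma finite_multisets_of_size:
  assumes "finite S"
  shows "finite (multisets_of_size S n)"
  using assms
proof (induction S arbitrary: n)
  case empty
  show ?case by (cases "n = 0") auto
next
  case (insert x S)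
  show ?case
    by (induction n) (use insert in \<open>simp_all add: multisets_of_size_insert_Suc\<close>)
qed

lemma complete_hom_insert_Suc:
  assumes "finite S" "x \<notin> S"
  shows "complete_hom a (insert x S) (Suc n) = complete_hom a S (Suc n) + a x * complete_hom a (insert x S) n"
proof -
  have "multisets_of_size S (Suc n) \<inter> add_mset x ` multisets_of_size (insert x S) n = {}"
    using \<open>x \<notin> S\<close> by (auto simp: multisets_of_size_def)
  then have "complete_hom a (insert x S) (Suc n) = complete_hom a S (Suc n)
      + (\<Sum>M\<in>add_mset x ` multisets_of_size (insert x S) n. \<Prod>x\<in>#M. a x)"
    using assms unfolding complete_hom_def multisets_of_size_insert_Suc[OF assms(2)]
    by (intro sum.union_disjoint finite_imageI finite_multisets_of_size) auto
  also have "(\<Sum>M\<in>add_mset x ` multisets_of_size (insert x S) n. \<Prod>x\<in>#M. a x) = a x * complete_hom a (insert x S) n"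
    by (subst sum.reindex) (auto simp: complete_hom_def sum_distrib_left inj_on_def)
  finally show ?thesis .
qed

lemma complete_hom_generating_function:
  fixes a :: "'a \<Rightarrow> 'b::comm_ring_1"
  assumes "finite S"
  shows "Abs_fps (complete_hom a S) * (\<Prod>x\<in>S. 1 - fps_const (a x) * fps_X) = 1"
  using assms
proof induction
  case empty
  have "complete_hom a {} n = (if n = 0 then 1 else 0)" for n
    by (cases "n = 0") (auto simp: complete_hom_def)
  then show ?case by (simp add: fps_eq_iff)
next
  case (insert x S)
  have "Abs_fps (complete_hom a (insert x S)) * (1 - fps_const (a x) * fps_X) = Abs_fps (complete_hom a S)"
  proof (rule fps_ext)
    fix n
    show "fps_nth (Abs_fps (complete_hom a (insert x S)) * (1 - fps_const (a x) * fps_X)) n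
      = fps_nth (Abs_fps (complete_hom a S)) n"
    proof (cases n)
      case 0
      then show ?thesis by (simp add: complete_hom_def)
    next
      case (Suc m)
      have "Abs_fps (complete_hom a (insert x S)) * (1 - fps_const (a x) * fps_X)
        = Abs_fps (complete_hom a (insert x S)) - fps_X * (fps_const (a x) * Abs_fps (complete_hom a (insert x S)))"
        by (simp add: algebra_simps)
      then show ?thesis
        using insert by (simp add: Suc complete_hom_insert_Suc)
    qed
  qed
  then show ?case
    using insert by (simp flip: mult.assoc)
qed

text \<open>
As \<open>j\<close> varies, \<open>c * w ^ j\<close> runs through all \<open>d\<close>-th roots of unity. Both sides are polynomials of degree at
most \<open>d\<close> that agree at \<open>0\<close> and at the \<open>d\<close> points \<open>w ^ i / c\<close>.
\<close>

lemma prod_one_minus_root_powers: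
  fixes w c :: complex
  assumes "d > 0" "w ^ d = 1" and prim: "\<And>j. 0 < j \<Longrightarrow> j < d \<Longrightarrow> w ^ j \<noteq> 1" and "c ^ d = 1"
  shows "(\<Prod>j<d. 1 - fps_const (c * w ^ j) * fps_X) = 1 - fps_X ^ d"
proof -
  have "w \<noteq> 0" "c \<noteq> 0" using assms by (auto simp: power_0_left)
  have inj: "inj_on (\<lambda>i. w ^ i / c) {..<d}"
  proof (rule linorder_inj_onI')
    fix i j assume "i \<in> {..<d}" "j \<in> {..<d}" "i < j"
    then have "w ^ (j - i) \<noteq> 1" using prim by simp
    then show "w ^ i / c \<noteq> w ^ j / c"
      using \<open>i < j\<close> \<open>w \<noteq> 0\<close> \<open>c \<noteq> 0\<close> by (simp add: power_diff)
  qed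
  define f :: "complex poly" where "f = (\<Prod>j<d. [:1, - (c * w ^ j):]) - (1 - monom 1 d)"
  have "degree (\<Prod>j<d. [:1, - (c * w ^ j):]) \<le> (\<Sum>j<d. degree [:1, - (c * w ^ j):])"
    by (rule degree_prod_sum_le[unfolded comp_def]) simp
  also have "\<dots> \<le> (\<Sum>j<d. 1)"
    by (rule sum_mono) simp
  finally have "degree f \<le> d"
    unfolding f_def by (intro degree_diff_le) (auto intro: degree_monom_le)
  \<comment> \<open>One point more than the degree allows for a nonzero polynomial.\<close>
  define R where "R = insert 0 ((\<lambda>i. w ^ i / c) ` {..<d})"
  have "card R = Suc d"
  proof -
    have "0 \<notin> (\<lambda>i. w ^ i / c) ` {..<d}"
      using \<open>w \<noteq> 0\<close> \<open>c \<noteq> 0\<close> by auto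
    then show ?thesis by (simp add: R_def card_image[OF inj])
  qed
  have "R \<subseteq> {x. poly f x = 0}"
  proof
    fix x assume "x \<in> R"
    then consider "x = 0" | i where "i < d" "x = w ^ i / c" by (auto simp: R_def)
    then show "x \<in> {x. poly f x = 0}"
    proof cases
      case 1
      then show ?thesis using \<open>d > 0\<close> by (simp add: f_def poly_prod poly_monom)
    next
      case 2
      define j where "j = (if i = 0 then 0 else d - i)"
      have "w ^ j * w ^ i = 1" and "j < d"
        using 2 assms by (auto simp: j_def simp flip: power_add)
      then have "\<exists>j<d. c * (w ^ j * x) = 1"
        using 2 \<open>c \<noteq> 0\<close> by auto
      then have "poly (\<Prod>j<d. [:1, - (c * w ^ j):]) x = 0"
        by (auto simp: poly_prod mult.commute mult.left_commute)
      moreover have "x ^ d = 1"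
        using 2 assms by (simp add: power_divide power_mult[symmetric] mult.commute[of i d])
          (simp add: power_mult)
      ultimately show ?thesis
        by (simp add: f_def poly_monom)
    qed
  qed
  have "f = 0"
  proof (rule ccontr)
    assume "f \<noteq> 0"
    then have "card R \<le> degree f"
      using card_poly_roots_bound[of f] card_mono[OF poly_roots_finite \<open>R \<subseteq> _\<close>] by linarith
    then show False using \<open>card R = _\<close> \<open>degree f \<le> d\<close> by simp
  qed
  then have "fps_of_poly (\<Prod>j<d. [:1, - (c * w ^ j):]) = fps_of_poly (1 - monom 1 d)"
    by (simp add: f_def)
  moreover have "fps_of_poly [:1, - x:] = 1 - fps_const x * fps_X" for x :: complex
    unfolding fps_of_poly_linear' by (simp flip: fps_const_neg)
  ultimately show ?thesis
    by (simp add: fps_of_poly_prod fps_of_poly_diff fps_of_poly_monom')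
qed

lemma fps_power_eq_imp_eq:
  fixes P Q :: "'a::field_char_0 fps"
  assumes "P ^ d = Q ^ d" "d > 0" "fps_nth P 0 = 1" "fps_nth Q 0 = 1"
  shows "P = Q"
proof -
  \<comment> \<open>The cofactor of \<open>P - Q\<close> in \<open>P ^ d - Q ^ d\<close>; its constant term is \<open>d\<close>.\<close>
  define S where "S = (\<Sum>i<d. Q ^ (d - Suc i) * P ^ i)"
  have "(P - Q) * S = 0"
    using power_diff_sumr2[of P d Q] assms(1) by (simp add: S_def)
  moreover have "fps_nth S 0 = of_nat d"
    using assms(3,4) by (simp add: S_def fps_sum_nth fps_power_zeroth)
  then have "S \<noteq> 0" using \<open>d > 0\<close> by auto
  ultimately show ?thesis by simp
qed

lemma fps_nth_inverse_one_minus_X_power: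
  fixes d e :: nat
  assumes "d > 0" "e > 0"
  shows "fps_nth (inverse ((1 - fps_X ^ d) ^ e)) (d * e) = (of_nat (central_choose e) :: 'a::field_char_0)"
proof -
  have "(1 - fps_X ^ d) ^ e = ((1 - fps_X) ^ e oo (fps_X ^ d) :: 'a fps)"
    using \<open>d > 0\<close> by (simp add: fps_compose_power[symmetric] fps_compose_sub_distrib)
  then have "inverse ((1 - fps_X ^ d) ^ e) = (inverse ((1 - fps_X) ^ e) oo (fps_X ^ d) :: 'a fps)"
    using \<open>d > 0\<close> by (simp add: fps_inverse_compose fps_power_zeroth)
  also have "inverse ((1 - fps_X) ^ e) = (Abs_fps (\<lambda>k. of_nat ((e + k - 1) choose k)) :: 'a fps)"
    using one_minus_const_fps_X_neg_power'[OF \<open>e > 0\<close>, of "1 :: 'a"] by simp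
  also have "fps_nth (\<dots> oo (fps_X ^ d)) (d * e) = (of_nat ((e + e - 1) choose e) :: 'a)"
  proof -
    have nth: "fps_nth ((fps_X ^ d) ^ i) (d * e) = (if i = e then 1 else 0 :: 'a)" for i
      using \<open>d > 0\<close> by (auto simp: fps_X_power_nth simp flip: power_mult)
    show ?thesis
      unfolding fps_compose_nth nth using \<open>d > 0\<close> by (simp add: if_distrib cong: if_cong)
  qed
  also have "(e + e - 1) choose e = central_choose e"
    using binomial_symmetric[of e "e + e - 1"] \<open>e > 0\<close> by (simp add: central_choose_def mult_2)
  finally show ?thesis .
qed

text \<open>
The element \<open>w\<close> witnesses that the character has order exactly \<open>d\<close>. The values of \<open>\<chi>\<close> are equidistributed
on the \<open>d\<close>-th roots of unity, so the product \<open>P\<close> of the factors \<open>1 - \<chi> x * X\<close> is \<open>(1 - X ^ d) ^ e\<close>. This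
is obtained without counting fibres: translation by a power of \<open>w\<close> permutes the group, hence \<open>P ^ d\<close> is a product
over \<open>x\<close> and over the powers of \<open>\<chi> w\<close>, and \<open>d\<close>-th roots of power series with constant term \<open>1\<close> are unique.
\<close>

lemma (in group) complete_hom_character:
  fixes \<chi> :: "'a \<Rightarrow> complex"
  assumes fin: "finite (carrier G)" and hom: "\<And>x y. x \<in> carrier G \<Longrightarrow> y \<in> carrier G \<Longrightarrow> \<chi> (x \<otimes> y) = \<chi> x * \<chi> y"
    and ord: "Coset.order G = d * e" "d > 0"
    and exp: "\<And>x. x \<in> carrier G \<Longrightarrow> \<chi> x ^ d = 1"
    and w: "w \<in> carrier G" and prim: "\<And>j. 0 < j \<Longrightarrow> j < d \<Longrightarrow> \<chi> w ^ j \<noteq> 1"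
  shows "complete_hom \<chi> (carrier G) (Coset.order G) = of_nat (central_choose e)"
proof -
  have "e > 0"
    using fin ord order_gt_0_iff_finite by fastforce
  define P where "P = (\<Prod>x\<in>carrier G. 1 - fps_const (\<chi> x) * fps_X)"
  have "\<chi> \<one> \<noteq> 0" using exp[of \<one>] ord by (auto simp: power_0_left)
  then have "\<chi> \<one> = 1" using hom[of \<one> \<one>] by simp
  then have pow: "\<chi> (w [^] (j::nat)) = \<chi> w ^ j" for j
    by (induction j) (use w hom in \<open>auto simp: mult.commute\<close>)
  have shift: "P = (\<Prod>x\<in>carrier G. 1 - fps_const (\<chi> x * \<chi> w ^ j) * fps_X)" for j :: nat
  proof -
    have "bij_betw (\<lambda>x. x \<otimes> w [^] j) (carrier G) (carrier G)"
      by (rule bij_betw_byWitness[where f' = "\<lambda>x. x \<otimes> inv (w [^] j)"]) (use w in \<open>auto simp: m_assoc\<close>)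
    from prod.reindex_bij_betw[OF this, of "\<lambda>x. 1 - fps_const (\<chi> x) * fps_X", symmetric]
    show ?thesis unfolding P_def using w by (simp add: hom pow)
  qed
  have P0: "fps_nth P 0 = 1"
    unfolding P_def using fin by induction auto
  have "P ^ d = (\<Prod>j<d. \<Prod>x\<in>carrier G. 1 - fps_const (\<chi> x * \<chi> w ^ j) * fps_X)"
    by (simp flip: shift)
  also have "\<dots> = (\<Prod>x\<in>carrier G. \<Prod>j<d. 1 - fps_const (\<chi> x * \<chi> w ^ j) * fps_X)"
    by (rule prod.swap)
  also have "\<dots> = (\<Prod>x\<in>carrier G. 1 - fps_X ^ d)"
    using w exp prim \<open>d > 0\<close> by (intro prod.cong refl prod_one_minus_root_powers) auto
  also have "\<dots> = ((1 - fps_X ^ d) ^ e) ^ d"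
    using ord by (simp add: Coset.order_def mult.commute flip: power_mult)
  finally have "P = (1 - fps_X ^ d) ^ e"
    by (rule fps_power_eq_imp_eq) (use \<open>d > 0\<close> P0 in \<open>auto simp: fps_power_zeroth power_0_left\<close>)
  moreover have "Abs_fps (complete_hom \<chi> (carrier G)) = inverse P"
    using complete_hom_generating_function[OF fin, of \<chi>] unfolding P_def
    by (metis fps_inverse_unique mult.commute)
  ultimately have "Abs_fps (complete_hom \<chi> (carrier G)) = inverse ((1 - fps_X ^ d) ^ e)"
    by simp
  then have "fps_nth (Abs_fps (complete_hom \<chi> (carrier G))) (d * e) = of_nat (central_choose e)"
    using fps_nth_inverse_one_minus_X_power[OF \<open>d > 0\<close> \<open>e > 0\<close>] by simp
  then show ?thesis by (simp add: ord)
qed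

text \<open>
Character orthogonality picks out the multisets with product \<open>\<one>\<close>.
\<close>

lemma (in comm_group) card_multisets_prod_one:
  fixes \<chi> :: "'t \<Rightarrow> 'a \<Rightarrow> complex"
  assumes fin: "finite (carrier G)"
    and hom: "\<And>t x y. t \<in> T \<Longrightarrow> x \<in> carrier G \<Longrightarrow> y \<in> carrier G \<Longrightarrow> \<chi> t (x \<otimes> y) = \<chi> t x * \<chi> t y"
    and one: "\<And>t. t \<in> T \<Longrightarrow> \<chi> t \<one> = 1"
    and orth: "\<And>x. x \<in> carrier G \<Longrightarrow> (\<Sum>t\<in>T. \<chi> t x) = (if x = \<one> then of_nat (Coset.order G) else 0)"
  shows "of_nat (Coset.order G * card {M \<in> multisets_of_size (carrier G) n. mset_prod G M = \<one>})
    = (\<Sum>t\<in>T. complete_hom (\<chi> t) (carrier G) n)"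
proof -
  let ?\<M> = "multisets_of_size (carrier G) n"
  have \<chi>M: "(\<Prod>x\<in>#M. \<chi> t x) = \<chi> t (mset_prod G M)" if "t \<in> T" "set_mset M \<subseteq> carrier G" for t M
    using that(2) by (induction M) (use that(1) one hom in \<open>auto simp: mset_prod_add[OF fin]\<close>)
  have "(\<Sum>t\<in>T. complete_hom (\<chi> t) (carrier G) n) = (\<Sum>t\<in>T. \<Sum>M\<in>?\<M>. \<chi> t (mset_prod G M))"
    unfolding complete_hom_def by (intro sum.cong refl \<chi>M) (auto simp: multisets_of_size_def)
  also have "\<dots> = (\<Sum>M\<in>?\<M>. \<Sum>t\<in>T. \<chi> t (mset_prod G M))"
    by (rule sum.swap)
  also have "\<dots> = (\<Sum>M\<in>?\<M>. if mset_prod G M = \<one> then of_nat (Coset.order G) else 0)"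
    by (intro sum.cong refl orth) simp
  also have "\<dots> = of_nat (Coset.order G * card {M \<in> ?\<M>. mset_prod G M = \<one>})"
    using finite_multisets_of_size[OF fin, of n] by (simp add: sum.If_cases Int_def)
  finally show ?thesis by simp
qed

section \<open>Abelian p-groups\<close>

definition root_char :: "nat \<Rightarrow> int \<Rightarrow> complex" where
  "root_char q x = cis (2 * pi * of_int x / of_nat q)"

lemma root_char_0 [simp]: "root_char q 0 = 1"
  by (simp add: root_char_def)

lemma root_char_add: "root_char q (x + y) = root_char q x * root_char q y"
  by (simp add: root_char_def cis_mult ring_distribs add_divide_distrib)

lemma root_char_power: "root_char q x ^ n = root_char q (int n * x)"
  by (induction n) (simp_all add: root_char_add algebra_simps)

lemma root_char_eq_1_iff:
  assumes "q > 0"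
  shows "root_char q x = 1 \<longleftrightarrow> int q dvd x"
proof -
  have "root_char q x = 1 \<longleftrightarrow> (\<exists>n. 2 * pi * of_int x / of_nat q = of_int n * (2 * pi))"
    unfolding root_char_def cis_eq_1_iff ..
  also have "\<dots> \<longleftrightarrow> (\<exists>n. (of_int x :: real) = of_int (int q * n))"
    using assms by (simp add: field_simps)
  also have "\<dots> \<longleftrightarrow> int q dvd x"
    unfolding of_int_eq_iff by (auto simp: dvd_def)
  finally show ?thesis .
qed

lemma root_char_mult_mod:
  assumes "q > 0"
  shows "root_char q (t * (x mod int q)) = root_char q (t * x)"
proof -
  have "t * x = t * (x mod int q) + int q * (t * (x div int q))"
    by (metis add.commute distrib_left mult.left_commute mult_div_mod_eq)
  moreover have "root_char q (int q * (t * (x div int q))) = 1"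
    using assms by (simp add: root_char_eq_1_iff)
  ultimately show ?thesis by (simp add: root_char_add)
qed

lemma sum_root_char:
  assumes "q > 0"
  shows "(\<Sum>t\<in>{0..<int q}. root_char q (t * x)) = (if int q dvd x then of_nat q else 0)"
proof -
  have "(\<Sum>t\<in>{0..<int q}. root_char q (t * x)) = (\<Sum>t\<in>{0..<q}. root_char q (int t * x))"
    unfolding image_int_atLeastLessThan[of 0 q, simplified, symmetric]
    by (subst sum.reindex) (auto simp: inj_on_def)
  also have "\<dots> = (\<Sum>t<q. root_char q x ^ t)"
    by (simp add: root_char_power atLeast0LessThan)
  also have "\<dots> = (if int q dvd x then of_nat q else 0)"
  proof (cases "int q dvd x")
    case True
    then have "root_char q x = 1" using assms by (simp add: root_char_eq_1_iff)
    then show ?thesis using True by simp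
  next
    case False
    then have "root_char q x \<noteq> 1" using assms by (simp add: root_char_eq_1_iff)
    moreover have "root_char q x ^ q = 1" using assms by (simp add: root_char_power root_char_eq_1_iff)
    ultimately show ?thesis using False by (simp add: geometric_sum)
  qed
  finally show ?thesis .
qed

text \<open>
The pairing of a product of cyclic groups with itself: every character has this form, and the
index set of the characters is again the carrier of the group.
\<close>

definition product_char :: "'i set \<Rightarrow> ('i \<Rightarrow> nat) \<Rightarrow> ('i \<Rightarrow> int) \<Rightarrow> ('i \<Rightarrow> int) \<Rightarrow> complex" where
  "product_char I q t g = (\<Prod>i\<in>I. root_char (q i) (t i * g i))"

locale cyclic_product =
  fixes I :: "'i set" and q :: "'i \<Rightarrow> nat" and G :: "('i \<Rightarrow> int) monoid"
  assumes finite_index: "finite I" and modulus_pos: "\<And>i. i \<in> I \<Longrightarrow> q i > 0"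
    and G_def: "G = product_group I (\<lambda>i. integer_mod_group (q i))"
begin

lemma carrier_G: "carrier G = (\<Pi>\<^sub>E i\<in>I. {0..<int (q i)})"
  unfolding G_def carrier_product_group
  by (rule PiE_cong) (use modulus_pos in \<open>simp add: carrier_integer_mod_group\<close>)

lemma finite_carrier_G: "finite (carrier G)"
  unfolding carrier_G using finite_index by (intro finite_PiE) auto

lemma order_G: "Coset.order G = (\<Prod>i\<in>I. q i)"
  unfolding Coset.order_def carrier_G by (simp add: card_PiE[OF finite_index])

lemma one_G: "\<one>\<^bsub>G\<^esub> = (\<lambda>i\<in>I. 0)"
  by (simp add: G_def)

lemma mult_G: "x \<otimes>\<^bsub>G\<^esub> y = (\<lambda>i\<in>I. (x i + y i) mod int (q i))"
  by (simp add: G_def)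

sublocale comm_group G
proof (rule group.group_comm_groupI)
  show "Group.group G" by (simp add: G_def)
qed (simp add: mult_G add.commute)

lemma product_char_mult: "product_char I q t (x \<otimes>\<^bsub>G\<^esub> y) = product_char I q t x * product_char I q t y"
  unfolding product_char_def prod.distrib[symmetric]
  by (intro prod.cong refl)
    (simp add: mult_G root_char_mult_mod modulus_pos distrib_left flip: root_char_add)

lemma product_char_one: "product_char I q t \<one>\<^bsub>G\<^esub> = 1"
  by (simp add: product_char_def one_G)

lemma product_char_power: "product_char I q t x ^ n = (\<Prod>i\<in>I. root_char (q i) (int n * t i * x i))"
  by (simp add: product_char_def prod_power_distrib root_char_power mult.assoc)

lemma sum_product_char:
  assumes "x \<in> carrier G"
  shows "(\<Sum>t\<in>carrier G. product_char I q t x) = (if x = \<one>\<^bsub>G\<^esub> then of_nat (Coset.order G) else 0)"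
proof -
  have "(\<Sum>t\<in>carrier G. product_char I q t x) = (\<Prod>i\<in>I. \<Sum>t\<in>{0..<int (q i)}. root_char (q i) (t * x i))"
    unfolding carrier_G product_char_def using finite_index by (subst prod_sum_PiE) auto
  also have "\<dots> = (\<Prod>i\<in>I. if int (q i) dvd x i then of_nat (q i) else 0)"
    using modulus_pos by (intro prod.cong refl sum_root_char) auto
  also have "\<dots> = (if x = \<one>\<^bsub>G\<^esub> then of_nat (Coset.order G) else 0)"
  proof (cases "x = \<one>\<^bsub>G\<^esub>")
    case True
    then show ?thesis by (simp add: one_G order_G)
  next
    case False
    then obtain i where i: "i \<in> I" "x i \<noteq> 0"
      using assms unfolding carrier_G one_G by (metis (no_types, lifting) PiE_restrict restrict_ext)
    moreover have "0 \<le> x i" "x i < int (q i)" using assms i by (auto simp: carrier_G PiE_iff)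
    ultimately have "\<not> int (q i) dvd x i" by (auto dest: zdvd_imp_le)
    then show ?thesis using False i finite_index by auto
  qed
  finally show ?thesis .
qed

lemma num_monomials_eq_sum_complete_hom:
  "of_nat (Coset.order G * num_monomials (group_permanent G))
    = (\<Sum>t\<in>carrier G. complete_hom (product_char I q t) (carrier G) (Coset.order G))"
  unfolding num_monomials_group_permanent[OF finite_carrier_G] quotient_msets_eq[OF finite_carrier_G]
  by (rule card_multisets_prod_one[OF finite_carrier_G])
    (simp_all add: product_char_mult product_char_one sum_product_char)

end

lemma Collect_PiE_eq: "{t \<in> Pi\<^sub>E I A. \<forall>i\<in>I. P i (t i)} = (\<Pi>\<^sub>E i\<in>I. {x \<in> A i. P i x})"
  by (auto simp: PiE_iff extensional_def)

text \<open>
The character with index \<open>t\<close> has order \<open>p ^ char_level p ks t\<close>, which is also the order of \<open>t\<close> in the group.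
\<close>

definition char_level :: "nat \<Rightarrow> nat list \<Rightarrow> (nat \<Rightarrow> int) \<Rightarrow> nat" where
  "char_level p ks t = (LEAST j. \<forall>i<length ks. int (p ^ (ks ! i)) dvd int (p ^ j) * t i)"

locale abelian_p_type =
  fixes p :: nat and ks :: "nat list"
  assumes p: "prime p"
begin

abbreviation "I \<equiv> {..<length ks}"
abbreviation "q i \<equiv> p ^ (ks ! i)"
abbreviation "m \<equiv> sum_list ks"

sublocale cyclic_product "{..<length ks}" "\<lambda>i. p ^ (ks ! i)" "abelian_p_group p ks"
  by unfold_locales (use p in \<open>auto simp: abelian_p_group_def prime_gt_0_nat\<close>)

lemma order_abelian_p_group: "Coset.order (abelian_p_group p ks) = p ^ m"
  by (simp add: order_G sum_list_sum_nth atLeast0LessThan power_sum)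

lemma part_le: "i < length ks \<Longrightarrow> ks ! i \<le> m"
  by (simp add: member_le_sum_list)

lemma annihilated_m: "i < length ks \<Longrightarrow> int (p ^ (ks ! i)) dvd int (p ^ m) * t i"
  using part_le by (simp add: le_imp_power_dvd)

lemma char_level_le_iff:
  "char_level p ks t \<le> j \<longleftrightarrow> (\<forall>i<length ks. int (p ^ (ks ! i)) dvd int (p ^ j) * t i)"
proof
  assume "char_level p ks t \<le> j"
  moreover have "\<forall>i<length ks. int (p ^ (ks ! i)) dvd int (p ^ char_level p ks t) * t i"
    unfolding char_level_def by (rule LeastI[of _ m]) (use annihilated_m in blast)
  ultimately show "\<forall>i<length ks. int (p ^ (ks ! i)) dvd int (p ^ j) * t i"
    by (metis dvd_trans int_dvd_int_iff le_imp_power_dvd dvd_refl mult_dvd_mono)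
qed (simp add: char_level_def Least_le)

text \<open>
If the level is \<open>j > 0\<close>, some coordinate \<open>i\<close> of \<open>t\<close> is not annihilated by \<open>p ^ (j - 1)\<close>. The character then takes a
primitive root of unity of order \<open>p ^ j\<close> as its value at the \<open>i\<close>-th unit vector.
\<close>

lemma complete_hom_product_char:
  assumes t: "t \<in> carrier (abelian_p_group p ks)"
  shows "complete_hom (product_char I q t) (carrier (abelian_p_group p ks)) (Coset.order (abelian_p_group p ks))
    = of_nat (central_choose (p ^ (m - char_level p ks t)))"
proof -
  let ?G = "abelian_p_group p ks"
  define j where "j = char_level p ks t"
  have "j \<le> m" using char_level_le_iff annihilated_m by (simp add: j_def)
  have exp: "product_char I q t x ^ p ^ j = 1" for x
    unfolding product_char_power
  proof (rule prod.neutral, rule ballI)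
    fix i assume "i \<in> I"
    then have "int (q i) dvd int (p ^ j) * t i" using char_level_le_iff[of t j] by (auto simp: j_def)
    then show "root_char (q i) (int (p ^ j) * t i * x i) = 1"
      using modulus_pos[OF \<open>i \<in> I\<close>] by (subst root_char_eq_1_iff) auto
  qed
  have "\<exists>w\<in>carrier ?G. \<forall>n. 0 < n \<longrightarrow> n < p ^ j \<longrightarrow> product_char I q t w ^ n \<noteq> 1"
  proof (cases "j = 0")
    case True
    then show ?thesis by (intro bexI[of _ "\<one>\<^bsub>?G\<^esub>"]) auto
  next
    case False
    then have "\<not> char_level p ks t \<le> j - 1" by (simp add: j_def)
    then obtain i where i: "i \<in> I" and ndvd: "\<not> int (q i) dvd int (p ^ (j - 1)) * t i"
      unfolding char_level_le_iff by auto
    have "q i \<noteq> 1" using ndvd by (metis of_nat_1 one_dvd)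
    then have qi: "1 < int (q i)" using modulus_pos[OF i] by linarith
    define w where "w = (\<lambda>i'\<in>I. if i' = i then 1 else 0 :: int)"
    have "w \<in> carrier ?G"
      unfolding carrier_G using qi modulus_pos by (auto simp: w_def)
    moreover have "product_char I q t w ^ n \<noteq> 1" if n: "0 < n" "n < p ^ j" for n
    proof
      assume "product_char I q t w ^ n = 1"
      also have "product_char I q t w ^ n = (\<Prod>i'\<in>I. if i' = i then root_char (q i) (int n * t i) else 1)"
        unfolding product_char_power by (intro prod.cong refl) (auto simp: w_def)
      also have "\<dots> = root_char (q i) (int n * t i)"
        using i by simp
      finally have "int (q i) dvd int n * t i"
        using modulus_pos[OF i] by (simp add: root_char_eq_1_iff)
      moreover have "int (q i) dvd int (p ^ j) * t i"
        using char_level_le_iff[of t j] i by (auto simp: j_def)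
      ultimately have "int (q i) dvd gcd (int n * t i) (int (p ^ j) * t i)"
        by simp
      also have "gcd (int n * t i) (int (p ^ j) * t i) = gcd (int n) (int (p ^ j)) * \<bar>t i\<bar>"
        using gcd_mult_distrib_int[of "t i" "int n" "int (p ^ j)"] by (simp only: mult.commute)
      also have "gcd (int n) (int (p ^ j)) = int (gcd n (p ^ j))"
        by (rule gcd_int_int_eq)
      also have "int (gcd n (p ^ j)) * \<bar>t i\<bar> dvd int (gcd n (p ^ j)) * t i"
        by (intro mult_dvd_mono dvd_refl) simp
      finally have dv: "int (q i) dvd int (gcd n (p ^ j)) * t i" .
      obtain a where a: "a \<le> j" "gcd n (p ^ j) = p ^ a"
        using divides_primepow_nat[OF p, of "gcd n (p ^ j)" j] by auto
      have "gcd n (p ^ j) \<le> n" using n by (simp add: gcd_le1_nat)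
      then have "a < j" using a n by (metis le_neq_implies_less not_le)
      then have "int (p ^ a) * t i dvd int (p ^ (j - 1)) * t i"
        by (intro mult_dvd_mono) (auto intro: le_imp_power_dvd)
      then show False using dv a ndvd dvd_trans by metis
    qed
    ultimately show ?thesis by blast
  qed
  then obtain w where w: "w \<in> carrier ?G" "\<And>n. 0 < n \<Longrightarrow> n < p ^ j \<Longrightarrow> product_char I q t w ^ n \<noteq> 1"
    by blast
  have "Coset.order ?G = p ^ j * p ^ (m - j)"
    using \<open>j \<le> m\<close> by (simp add: order_abelian_p_group flip: power_add)
  from complete_hom_character[OF finite_carrier_G product_char_mult this _ exp w] show ?thesis
    using p by (simp add: prime_gt_0_nat j_def)
qed

theorem num_monomials_formula:
  "p ^ m * num_monomials (group_permanent (abelian_p_group p ks))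
    = (\<Sum>t\<in>carrier (abelian_p_group p ks). central_choose (p ^ (m - char_level p ks t)))"
proof -
  have "complex_of_nat (p ^ m * num_monomials (group_permanent (abelian_p_group p ks)))
    = of_nat (\<Sum>t\<in>carrier (abelian_p_group p ks). central_choose (p ^ (m - char_level p ks t)))"
    using num_monomials_eq_sum_complete_hom unfolding of_nat_sum
    by (simp add: complete_hom_product_char order_abelian_p_group[symmetric] del: of_nat_mult cong: sum.cong)
  then show ?thesis by (simp only: of_nat_eq_iff)
qed

lemma card_mult_dvd:
  "card {x \<in> {0..<int (p ^ k)}. int (p ^ k) dvd int (p ^ j) * x} = p ^ min j k"
proof (cases "j \<ge> k")
  case True
  then have "int (p ^ k) dvd int (p ^ j) * x" for x by (simp add: le_imp_power_dvd)
  then have "{x \<in> {0..<int (p ^ k)}. int (p ^ k) dvd int (p ^ j) * x} = {0..<int (p ^ k)}" by blast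
  then show ?thesis using True by (simp add: min_def del: of_nat_power)
next
  case False
  define r where "r = int (p ^ (k - j))"
  have "r > 0" using p by (simp add: r_def prime_gt_0_nat)
  have pk: "int (p ^ k) = int (p ^ j) * r" using False by (simp add: r_def flip: power_add)
  have pj: "int (p ^ j) > 0" using p by (simp add: prime_gt_0_nat)
  have "{x \<in> {0..<int (p ^ k)}. int (p ^ k) dvd int (p ^ j) * x} = (*) r ` {0..<int (p ^ j)}"
  proof (intro equalityI subsetI)
    fix x assume x: "x \<in> {x \<in> {0..<int (p ^ k)}. int (p ^ k) dvd int (p ^ j) * x}"
    then have "r dvd x" using prime_gt_0_nat[OF p] by (simp add: pk del: of_nat_power)
    then obtain y where y: "x = r * y" by blast
    have "0 \<le> x" "x < int (p ^ k)" using x by simp_all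
    then have "0 \<le> r * y" "r * y < r * int (p ^ j)"
      unfolding y pk by (simp_all only: mult.commute)
    then have "0 \<le> y" "y < int (p ^ j)"
      using \<open>r > 0\<close> by (simp_all add: zero_le_mult_iff mult_less_cancel_left)
    then show "x \<in> (*) r ` {0..<int (p ^ j)}"
      unfolding y by (intro imageI) simp
  next
    fix x assume "x \<in> (*) r ` {0..<int (p ^ j)}"
    then obtain y where y: "x = r * y" and "y \<in> {0..<int (p ^ j)}" by (rule imageE)
    then have "0 \<le> x" "x < int (p ^ k)"
      unfolding pk using \<open>r > 0\<close> by (auto simp: mult.commute[of r] intro: mult_strict_right_mono)
    moreover have "int (p ^ k) dvd int (p ^ j) * x"
      unfolding pk y by simp
    ultimately show "x \<in> {x \<in> {0..<int (p ^ k)}. int (p ^ k) dvd int (p ^ j) * x}" by simp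
  qed
  then have "card {x \<in> {0..<int (p ^ k)}. int (p ^ k) dvd int (p ^ j) * x} = card {0..<int (p ^ j)}"
    using \<open>r > 0\<close> by (simp add: card_image inj_on_def)
  then show ?thesis using False by (simp add: min_def del: of_nat_power)
qed

lemma card_char_level_le:
  "card {t \<in> carrier (abelian_p_group p ks). char_level p ks t \<le> j} = p ^ (\<Sum>i\<in>I. min j (ks ! i))"
proof -
  have "{t \<in> carrier (abelian_p_group p ks). char_level p ks t \<le> j}
    = (\<Pi>\<^sub>E i\<in>I. {x \<in> {0..<int (q i)}. int (q i) dvd int (p ^ j) * x})"
    using Collect_PiE_eq[of I "\<lambda>i. {0..<int (q i)}" "\<lambda>i x. int (q i) dvd int (p ^ j) * x"]
    by (simp only: carrier_G char_level_le_iff Ball_def lessThan_iff)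
  then have "card {t \<in> carrier (abelian_p_group p ks). char_level p ks t \<le> j} = (\<Prod>i\<in>I. p ^ min j (ks ! i))"
    by (simp only: card_PiE[OF finite_index] card_mult_dvd)
  then show ?thesis by (simp add: power_sum)
qed

end

lemma min_sum_list_le: "min j (sum_list ks) \<le> (\<Sum>i<length ks. min j (ks ! i))" for ks :: "nat list"
proof -
  have "min j (sum_list ks) \<le> (\<Sum>k\<leftarrow>ks. min j k)"
    by (induction ks) auto
  also have "\<dots> = (\<Sum>i<length ks. min j (ks ! i))"
    by (simp add: sum_list_sum_nth atLeast0LessThan)
  finally show ?thesis .
qed

text \<open>
Summation by parts of the formula for \<open>p ^ m * num_monomials\<close>. The hypothesis \<open>small\<close> says that the
exponent of the group divides \<open>p ^ (m - 1)\<close>, so the term for \<open>k = 1\<close> carries the full weight \<open>p ^ m\<close>; the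
terms with \<open>k \<ge> 2\<close> are divisible by \<open>p ^ (m + 4)\<close>.
\<close>

lemma (in abelian_p_type) num_monomials_cong:
  assumes "p \<ge> 5" and "m > 0" and small: "\<And>i. i < length ks \<Longrightarrow> ks ! i < m"
  shows "[num_monomials (group_permanent (abelian_p_group p ks)) = central_choose p] (mod p ^ 4)"
proof -
  define N where "N = num_monomials (group_permanent (abelian_p_group p ks))"
  define B where "B k = int (central_choose (p ^ k))" for k
  define D where "D k = B k - B (k - 1)" for k
  define T where "T = carrier (abelian_p_group p ks)"
  \<comment> \<open>The number of characters whose order divides \<open>p ^ j\<close>.\<close>
  define C where "C j = card {t \<in> T. char_level p ks t \<le> j}" for j
  have finT: "finite T" using finite_carrier_G by (simp add: T_def)
  have cardT: "card T = p ^ m"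
    using order_abelian_p_group by (simp add: T_def Coset.order_def)
  have B0: "B 0 = 1" by (simp add: B_def central_choose_def)
  have telescope: "B a = 1 + (\<Sum>k\<in>{1..a}. D k)" for a
    by (induction a) (simp_all add: B0 D_def)
  have lev: "char_level p ks t \<le> m" for t
    using annihilated_m by (simp add: char_level_le_iff)
  have "int (p ^ m * N) = (\<Sum>t\<in>T. B (m - char_level p ks t))"
    unfolding N_def num_monomials_formula by (simp add: B_def T_def)
  also have "\<dots> = (\<Sum>t\<in>T. 1 + (\<Sum>k\<in>{1..m}. if char_level p ks t \<le> m - k then D k else 0))"
  proof (rule sum.cong[OF refl])
    fix t
    have "(\<Sum>k\<in>{1..m}. if char_level p ks t \<le> m - k then D k else 0) = (\<Sum>k\<in>{1..m - char_level p ks t}. D k)"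
      using lev[of t] by (intro sum.mono_neutral_cong_right) auto
    then show "B (m - char_level p ks t) = 1 + (\<Sum>k\<in>{1..m}. if char_level p ks t \<le> m - k then D k else 0)"
      by (simp add: telescope)
  qed
  also have "\<dots> = int (p ^ m) + (\<Sum>k\<in>{1..m}. D k * int (C (m - k)))"
    using finT by (subst sum.distrib, subst sum.swap) (simp add: cardT C_def sum.If_cases Int_def mult.commute)
  also have "(\<Sum>k\<in>{1..m}. D k * int (C (m - k))) = D 1 * int (C (m - 1)) + (\<Sum>k\<in>{2..m}. D k * int (C (m - k)))"
    using \<open>m > 0\<close> by (simp add: sum.atLeast_Suc_atMost numeral_2_eq_2)
  also have "C (m - 1) = p ^ m"
  proof -
    have "(\<Sum>i\<in>I. min (m - 1) (ks ! i)) = (\<Sum>i\<in>I. ks ! i)"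
      using small by (intro sum.cong refl) (fastforce simp: min_def)
    then show ?thesis
      by (simp add: C_def T_def card_char_level_le sum_list_sum_nth atLeast0LessThan)
  qed
  finally have eq: "int (p ^ m) * (int N - B 1) = (\<Sum>k\<in>{2..m}. D k * int (C (m - k)))"
    by (simp add: D_def B0 algebra_simps)
  have "int p ^ (m + 4) dvd D k * int (C (m - k))" if k: "k \<in> {2..m}" for k
  proof -
    have "int p ^ (3 * k) dvd D k"
      using central_choose_prime_power_cong[OF p \<open>p \<ge> 5\<close>, of k] k
      by (simp add: D_def B_def cong_iff_dvd_diff)
    moreover have "int p ^ (m - k) dvd int (C (m - k))"
    proof -
      have "m - k \<le> (\<Sum>i\<in>I. min (m - k) (ks ! i))"
        using min_sum_list_le[of "m - k" ks] by simp
      then show ?thesis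
        by (simp add: C_def T_def card_char_level_le le_imp_power_dvd)
    qed
    ultimately have "int p ^ (3 * k + (m - k)) dvd D k * int (C (m - k))"
      unfolding power_add by (rule mult_dvd_mono)
    moreover have "m + 4 \<le> 3 * k + (m - k)" using k by auto
    ultimately show ?thesis using le_imp_power_dvd dvd_trans by blast
  qed
  then have "int p ^ (m + 4) dvd int (p ^ m) * (int N - B 1)"
    unfolding eq by (intro dvd_sum) auto
  then have "int p ^ 4 dvd int N - B 1"
    using p by (simp add: power_add prime_gt_0_nat)
  then have "[int N = int (central_choose p)] (mod int (p ^ 4))"
    by (simp add: cong_iff_dvd_diff B_def)
  then show ?thesis
    by (simp only: cong_int_iff N_def)
qed

text \<open>
Reduction modulo \<open>p ^ k\<close> is an epimorphism from the integers. It follows that a noncyclic group of this kind has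
at least two parts in its type.
\<close>

lemma cyclic_abelian_p_group_singleton:
  assumes "prime p"
  shows "cyclic_group (abelian_p_group p [k])"
proof -
  interpret abelian_p_type p "[k]" by unfold_locales (rule assms)
  define f where "f n = (\<lambda>i\<in>{..<length [k]}. n mod int (p ^ k))" for n :: int
  have pk: "int (p ^ k) > 0" using assms by (simp add: prime_gt_0_nat)
  have fc: "f x \<in> carrier (abelian_p_group p [k])" for x
    using pk by (auto simp: carrier_G f_def)
  have "f \<in> hom integer_group (abelian_p_group p [k])"
  proof (rule homI)
    show "f x \<in> carrier (abelian_p_group p [k])" for x by (rule fc)
    show "f (x \<otimes>\<^bsub>integer_group\<^esub> y) = f x \<otimes>\<^bsub>abelian_p_group p [k]\<^esub> f y" for x y
    proof
      fix i
      show "f (x \<otimes>\<^bsub>integer_group\<^esub> y) i = (f x \<otimes>\<^bsub>abelian_p_group p [k]\<^esub> f y) i"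
        by (cases "i = 0") (simp_all add: f_def mult_G mod_add_eq)
    qed
  qed
  moreover have "f ` carrier integer_group = carrier (abelian_p_group p [k])"
  proof (intro equalityI subsetI)
    fix x assume x: "x \<in> carrier (abelian_p_group p [k])"
    then have "x = f (x 0)"
      unfolding carrier_G f_def by (intro extensionalityI[of _ "{..<length [k]}"]) (auto simp: PiE_iff)
    then show "x \<in> f ` carrier integer_group" by auto
  qed (use fc in auto)
  ultimately have "f \<in> epi integer_group (abelian_p_group p [k])"
    by (simp add: epi_def)
  then show ?thesis
    using group.cyclic_group_epimorphic_image[OF group_integer_group _ cyclic_integer_group] is_group by blast
qed

theorem corollary1p6:
  fixes p n :: nat and ks :: "nat list"
  assumes "prime p" and "p \<ge> 5"
    and "n \<ge> 1" and "is_partition ks n"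
    and "\<not> cyclic_group (abelian_p_group p ks)"
  shows "[num_monomials (group_permanent (abelian_p_group p ks)) = 1] (mod p ^ 4)
    \<longleftrightarrow> Wolstenholme_prime p"
proof -
  interpret abelian_p_type p ks by unfold_locales (rule assms)
  have n: "n = sum_list ks" and pos: "\<And>i. i < length ks \<Longrightarrow> ks ! i > 0"
    using assms(4) by (auto simp: is_partition_def Suc_le_eq)
  have "length ks \<noteq> 0" using \<open>n \<ge> 1\<close> n by auto
  moreover have "length ks \<noteq> 1"
    using cyclic_abelian_p_group_singleton[OF assms(1)] assms(5) by (auto simp: length_Suc_conv)
  ultimately have len: "length ks \<ge> 2" by linarith
  have "ks ! i < sum_list ks" if i: "i < length ks" for i
  proof -
    define i' :: nat where "i' = (if i = 0 then 1 else 0)"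
    have i': "i' < length ks" "i' \<noteq> i" using len by (auto simp: i'_def)
    have "ks ! i + ks ! i' = (\<Sum>j\<in>{i, i'}. ks ! j)" using i' by simp
    also have "\<dots> \<le> (\<Sum>j<length ks. ks ! j)" using i i' by (intro sum_mono2) auto
    also have "\<dots> = sum_list ks" by (simp add: sum_list_sum_nth atLeast0LessThan)
    finally show ?thesis using pos[OF i'(1)] by linarith
  qed
  then have "[num_monomials (group_permanent (abelian_p_group p ks)) = central_choose p] (mod p ^ 4)"
    using assms(2,3) n by (intro num_monomials_cong) auto
  then show ?thesis
    using \<open>prime p\<close> by (simp add: Wolstenholme_prime_def central_choose_def cong_def)
qed

end
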